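(* Let $\{X_n\}_{n=-\infty}^{\infty}$ be a real-valued stationary time series with $E(|X_0|^2)<\infty$, and let $\zeta_k$ and $g_k$ be the stopping times and estimators built from $\{X_n\}$, the partitions $\{\mathcal{P}_k\}$ and the block lengths $\{l_k\}$ as described in the context. If the conditional expectation $E(X_1\mid X_{-\infty}^{0})$ is almost surely continuous, then $$\lim_{k\to\infty}\left|g_k-E(X_{\zeta_k+1}\mid X_0^{\zeta_k})\right|=0\quad\text{almost surely.}$$
   Context: Notation: $X_m^n=(X_m,\dots,X_n)$ for $m\le n$, and $X_{-\infty}^0=(\dots,X_{-1},X_0)$. Partitions: $\{\mathcal{P}_k\}_{k=0}^\infty$ is a nested sequence (each $\mathcal{P}_{k+1}$ refines $\mathcal{P}_k$) of finite or countably infinite partitions of $\mathbb{R}$ by intervals. For $x\in\mathbb{R}$, $[x]^k$ denotes the unique interval of $\mathcal{P}_k$ containing $x$. For $C\subseteq\mathbb{R}$, $\mathrm{diam}(C)=\sup_{y,z\in C}|z-y|$. It is assumed that $\lim_{k\to\infty}\mathrm{diam}([x]^k)=0$ for all $x\in\mathbb{R}$. Write $[X_m^n]^k=([X_m]^k,\dots,[X_n]^k)$. Block lengths: $\{l_k\}_{k\ge1}$ is a nondecreasing sequence of positive integers with $1\le l_k\le k$ and $\lim_{k\to\infty}l_k=\infty$. Stopping times: $\zeta_0=0$ and, for $k\ge1$, $$\eta_k=\min\{t>0:\ [X_{\zeta_{k-1}-(l_k-1)+t}^{\zeta_{k-1}+t}]^k=[X_{\zeta_{k-1}-(l_k-1)}^{\zeta_{k-1}}]^k\},\qquad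 \zeta_k=\zeta_{k-1}+\eta_k,$$ where $t$ ranges over positive integers. (These are finite almost surely; their values on a null event are immaterial.) Estimator: for $k\ge1$, $g_k=\frac1k\sum_{j=0}^{k-1}X_{\zeta_j+1}$. Conditioning on $X_0^{\zeta_k}$ means conditioning on the stopped $\sigma$-algebra generated by the observations up to the stopping time $\zeta_k$; thus on $\{\zeta_k=n\}$, $E(X_{\zeta_k+1}\mid X_0^{\zeta_k})=E(X_{n+1}\mid X_0^n,\ \zeta_k=n)=E(X_{n+1}\mid X_0^n)$ (the event $\{\zeta_k=n\}$ is determined by $X_0^n$). Almost sure continuity: let $\mathbb{R}^{*-}$ be the set of all one-sided real sequences $(\dots,x_{-1},x_0)$ with metric $$d^*((\dots,x_{-1},x_0),(\dots,y_{-1},y_0))=\sum_{i=0}^\infty 2^{-i-1}\frac{|x_{-i}-y_{-i}|}{1+|x_{-i}-y_{-i}|}.$$ The conditional expectation $E(X_1\mid\dots,X_{-1},X_0)$, viewed as a function (a version) on $\mathbb{R}^{*-}$, is almost surely continuous if there is a set $C\subseteq\mathbb{R}^{*-}$ which has probability one (under the distribution of $X_{-\infty}^0$) such that the conditional expectation restricted to $C$ is continuous with respect to $d^*$. *)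

theory Defs
  imports "HOL-Probability.Probability"
begin

section \<open>Real time series\<close>

text \<open>A time series is a family \<open>X :: int \<Rightarrow> 'a \<Rightarrow> real\<close> of random variables on \<open>M\<close>;
  its path at \<open>\<omega>\<close> is \<open>\<lambda>n. X n \<omega>\<close>.\<close>

definition stationary :: "'a measure \<Rightarrow> (int \<Rightarrow> 'a \<Rightarrow> real) \<Rightarrow> bool" where
  "stationary M X \<longleftrightarrow>
     (\<forall>h. distr M (\<Pi>\<^sub>M i\<in>UNIV. borel) (\<lambda>\<omega> i. X (i + h) \<omega>) =
          distr M (\<Pi>\<^sub>M i\<in>UNIV. borel) (\<lambda>\<omega> i. X i \<omega>))"

definition sigma_gen_by :: "'a measure \<Rightarrow> (int \<Rightarrow> 'a \<Rightarrow> real) \<Rightarrow> int set \<Rightarrow> 'a measure" where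
  "sigma_gen_by M X I =
     vimage_algebra (space M) (\<lambda>\<omega>. \<lambda>i\<in>I. X i \<omega>) (\<Pi>\<^sub>M i\<in>I. borel)"

text \<open>The filtration of the observations \<open>X 0, X 1, \<dots>\<close> is indexed by \<^typ>\<open>enat\<close>, because the
  stopping times below take the value \<open>\<infinity>\<close> when the required recurrence never occurs.\<close>

definition observations :: "'a measure \<Rightarrow> (int \<Rightarrow> 'a \<Rightarrow> real) \<Rightarrow> enat \<Rightarrow> 'a measure" where
  "observations M X t = sigma_gen_by M X {i. 0 \<le> i \<and> enat (nat i) \<le> t}"

lemma filtration_observations: "filtration (space M) (observations M X)"
proof
  show "space (observations M X t) = space M" for t
    by (simp add: observations_def sigma_gen_by_def)
  fix s t :: enat assume "s \<le> t"
  define I where "I = (\<lambda>t. {i. 0 \<le> i \<and> enat (nat i) \<le> t})"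
  have sub: "I s \<subseteq> I t"
    using \<open>s \<le> t\<close> by (auto simp: I_def intro: order_trans)
  have "(\<lambda>\<omega>. \<lambda>i\<in>I s. (\<lambda>i\<in>I t. X i \<omega>) i)
          \<in> measurable (sigma_gen_by M X (I t)) (\<Pi>\<^sub>M i\<in>I s. borel)"
  proof (rule measurable_restrict)
    fix i assume "i \<in> I s"
    with sub have i: "i \<in> I t" by auto
    have "(\<lambda>\<omega>. \<lambda>i\<in>I t. X i \<omega>) \<in> measurable (sigma_gen_by M X (I t)) (\<Pi>\<^sub>M i\<in>I t. borel)"
      unfolding sigma_gen_by_def
      by (rule measurable_vimage_algebra1) (auto simp: space_PiM)
    from measurable_compose[OF this measurable_component_singleton[OF i]]
    show "(\<lambda>\<omega>. (\<lambda>i\<in>I t. X i \<omega>) i) \<in> borel_measurable (sigma_gen_by M X (I t))" .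
  qed
  also have "(\<lambda>\<omega>. \<lambda>i\<in>I s. (\<lambda>i\<in>I t. X i \<omega>) i) = (\<lambda>\<omega>. \<lambda>i\<in>I s. X i \<omega>)"
    using sub by (auto simp: fun_eq_iff restrict_def)
  finally have "(\<lambda>\<omega>. \<lambda>i\<in>I s. X i \<omega>)
      \<in> measurable (sigma_gen_by M X (I t)) (\<Pi>\<^sub>M i\<in>I s. borel)" .
  moreover have "space M = space (sigma_gen_by M X (I t))"
    by (simp add: sigma_gen_by_def)
  ultimately have "sets (vimage_algebra (space M) (\<lambda>\<omega>. \<lambda>i\<in>I s. X i \<omega>) (\<Pi>\<^sub>M i\<in>I s. borel))
      \<subseteq> sets (sigma_gen_by M X (I t))"
    by (intro sets_image_in_sets) auto
  then show "sets (observations M X s) \<subseteq> sets (observations M X t)"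
    by (simp add: observations_def sigma_gen_by_def I_def)
qed

definition stopped_sigma :: "'a measure \<Rightarrow> (int \<Rightarrow> 'a \<Rightarrow> real) \<Rightarrow> ('a \<Rightarrow> enat) \<Rightarrow> 'a measure" where
  "stopped_sigma M X T = filtration.pre_sigma (space M) (observations M X) T"


section \<open>Quantization and recurrence times\<close>

text \<open>The extended real diameter is used since cells may be unbounded; the real-valued
  \<^const>\<open>diameter\<close> is meaningless for unbounded sets.\<close>

definition ediam :: "real set \<Rightarrow> ereal" where
  "ediam C = (SUP (y, z)\<in>C \<times> C. ereal \<bar>z - y\<bar>)"

definition cell :: "real set set \<Rightarrow> real \<Rightarrow> real set" where
  "cell Q x = (THE I. I \<in> Q \<and> x \<in> I)"

definition nested_interval_partitions :: "(nat \<Rightarrow> real set set) \<Rightarrow> bool" where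
  "nested_interval_partitions P \<longleftrightarrow>
     (\<forall>k. partition_on UNIV (P k) \<and> countable (P k) \<and> (\<forall>I\<in>P k. is_interval I)) \<and>
     (\<forall>k. refines UNIV (P (Suc k)) (P k))"

definition quantized_block :: "real set set \<Rightarrow> (int \<Rightarrow> real) \<Rightarrow> int \<Rightarrow> int \<Rightarrow> real set list" where
  "quantized_block Q x m n = map (\<lambda>i. cell Q (x i)) [m..n]"

text \<open>\<open>recurrence P l x k z\<close> is the recurrence time $\eta_k$ along the path \<open>x\<close> when
  $\zeta_{k-1}$ equals \<open>z\<close>; recall that the infimum of the empty set is \<open>\<infinity>\<close>.\<close>

definition recurrence ::
  "(nat \<Rightarrow> real set set) \<Rightarrow> (nat \<Rightarrow> nat) \<Rightarrow> (int \<Rightarrow> real) \<Rightarrow> nat \<Rightarrow> nat \<Rightarrow> enat" where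
  "recurrence P l x k z =
     Inf {enat t | t. 0 < t \<and>
       quantized_block (P k) x (int z - (int (l k) - 1) + int t) (int z + int t) =
       quantized_block (P k) x (int z - (int (l k) - 1)) (int z)}"

primrec zeta ::
  "(nat \<Rightarrow> real set set) \<Rightarrow> (nat \<Rightarrow> nat) \<Rightarrow> (int \<Rightarrow> real) \<Rightarrow> nat \<Rightarrow> enat" where
  "zeta P l x 0 = 0"
| "zeta P l x (Suc k) =
     (case zeta P l x k of
        enat z \<Rightarrow> enat z + recurrence P l x (Suc k) z
      | \<infinity> \<Rightarrow> \<infinity>)"

text \<open>The value $X_{\zeta_k+1}$; it is unspecified where $\zeta_k$ is infinite.\<close>

definition next_obs ::
  "(nat \<Rightarrow> real set set) \<Rightarrow> (nat \<Rightarrow> nat) \<Rightarrow> (int \<Rightarrow> real) \<Rightarrow> nat \<Rightarrow> real" where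
  "next_obs P l x k = x (int (the_enat (zeta P l x k)) + 1)"

definition estimator ::
  "(nat \<Rightarrow> real set set) \<Rightarrow> (nat \<Rightarrow> nat) \<Rightarrow> (int \<Rightarrow> real) \<Rightarrow> nat \<Rightarrow> real" where
  "estimator P l x k = (1 / real k) * (\<Sum>j<k. next_obs P l x j)"


section \<open>Almost sure continuity of the conditional expectation\<close>

text \<open>A one-sided sequence $(\dots,x_{-1},x_0)$ is represented by \<open>s :: nat \<Rightarrow> real\<close>
  with \<open>s i\<close> standing for $x_{-i}$.\<close>

definition past_dist :: "(nat \<Rightarrow> real) \<Rightarrow> (nat \<Rightarrow> real) \<Rightarrow> real" where
  "past_dist x y = (\<Sum>i. (1 / 2) ^ (i + 1) * (\<bar>x i - y i\<bar> / (1 + \<bar>x i - y i\<bar>)))"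

lemma summable_past_dist:
  fixes x y :: "nat \<Rightarrow> real"
  shows "summable (\<lambda>i. (1 / 2) ^ (i + 1) * (\<bar>x i - y i\<bar> / (1 + \<bar>x i - y i\<bar>)))"
proof (rule summable_comparison_test)
  show "summable (\<lambda>i. (1 / 2) ^ i :: real)"
    by (rule summable_geometric) simp
  have "(1 / 2) ^ (i + 1) * (\<bar>x i - y i\<bar> / (1 + \<bar>x i - y i\<bar>)) \<le> (1 / 2) ^ i * 1" for i
    by (rule mult_mono) (auto simp: divide_simps)
  then show "\<exists>N. \<forall>i\<ge>N.
      norm ((1 / 2) ^ (i + 1) * (\<bar>x i - y i\<bar> / (1 + \<bar>x i - y i\<bar>))) \<le> (1 / 2) ^ i"
    by simp
qed

lemma Metric_space_past_dist: "Metric_space UNIV past_dist"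
proof
  fix x y z :: "nat \<Rightarrow> real"
  define r :: "real \<Rightarrow> real" where "r = (\<lambda>t. t / (1 + t))"
  note sm = summable_past_dist
  show "0 \<le> past_dist x y"
    unfolding past_dist_def by (rule suminf_nonneg[OF sm]) simp
  show "past_dist x y = past_dist y x"
    unfolding past_dist_def by (simp add: abs_minus_commute)
  show "past_dist x y = 0 \<longleftrightarrow> x = y"
    unfolding past_dist_def
    by (subst suminf_eq_zero_iff[OF sm]) (auto simp: fun_eq_iff add_nonneg_eq_0_iff)
  have r: "r c \<le> r a + r b" if "0 \<le> a" "0 \<le> b" "0 \<le> c" "c \<le> a + b" for a b c :: real
  proof -
    have "r c \<le> r (a + b)"
      using that by (simp add: r_def divide_simps algebra_simps)
    also have "r (a + b) = a / (1 + (a + b)) + b / (1 + (a + b))"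
      by (simp add: r_def add_divide_distrib)
    also have "\<dots> \<le> r a + r b"
      unfolding r_def using that by (intro add_mono divide_left_mono mult_pos_pos) auto
    finally show ?thesis .
  qed
  have "past_dist x z \<le>
      (\<Sum>i. (1 / 2) ^ (i + 1) * (\<bar>x i - y i\<bar> / (1 + \<bar>x i - y i\<bar>)) +
           (1 / 2) ^ (i + 1) * (\<bar>y i - z i\<bar> / (1 + \<bar>y i - z i\<bar>)))"
    unfolding past_dist_def
  proof (rule suminf_le[OF _ sm summable_add[OF sm sm]])
    fix i
    have "r \<bar>x i - z i\<bar> \<le> r \<bar>x i - y i\<bar> + r \<bar>y i - z i\<bar>"
      by (rule r) auto
    then have "(1 / 2) ^ (i + 1) * r \<bar>x i - z i\<bar> \<le>
        (1 / 2) ^ (i + 1) * (r \<bar>x i - y i\<bar> + r \<bar>y i - z i\<bar>)"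
      by (rule mult_left_mono) simp
    then show "(1 / 2) ^ (i + 1) * (\<bar>x i - z i\<bar> / (1 + \<bar>x i - z i\<bar>)) \<le>
        (1 / 2) ^ (i + 1) * (\<bar>x i - y i\<bar> / (1 + \<bar>x i - y i\<bar>)) +
        (1 / 2) ^ (i + 1) * (\<bar>y i - z i\<bar> / (1 + \<bar>y i - z i\<bar>))"
      by (simp only: r_def distrib_left)
  qed
  also have "\<dots> = past_dist x y + past_dist y z"
    unfolding past_dist_def by (rule suminf_add[symmetric, OF sm sm])
  finally show "past_dist x z \<le> past_dist x y + past_dist y z" .
qed

definition past :: "(int \<Rightarrow> 'a \<Rightarrow> real) \<Rightarrow> 'a \<Rightarrow> nat \<Rightarrow> real" where
  "past X \<omega> = (\<lambda>i. X (- int i) \<omega>)"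

definition cond_exp_version ::
  "'a measure \<Rightarrow> (int \<Rightarrow> 'a \<Rightarrow> real) \<Rightarrow> ((nat \<Rightarrow> real) \<Rightarrow> real) \<Rightarrow> bool" where
  "cond_exp_version M X f \<longleftrightarrow>
     f \<in> borel_measurable (\<Pi>\<^sub>M i\<in>UNIV. borel) \<and>
     (AE \<omega> in M. f (past X \<omega>) = real_cond_exp M (sigma_gen_by M X {..0}) (X 1) \<omega>)"

definition cond_exp_as_continuous :: "'a measure \<Rightarrow> (int \<Rightarrow> 'a \<Rightarrow> real) \<Rightarrow> bool" where
  "cond_exp_as_continuous M X \<longleftrightarrow>
     (\<exists>f C. cond_exp_version M X f \<and>
        C \<in> sets (\<Pi>\<^sub>M i\<in>UNIV. borel) \<and>
        measure (distr M (\<Pi>\<^sub>M i\<in>UNIV. borel) (past X)) C = 1 \<and>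
        continuous_map (subtopology (Metric_space.mtopology UNIV past_dist) C) euclideanreal f)"

end

theory Submission
  imports Defs "HOL-Library.Discrete_Functions"
begin

text \<open>Write $V_k$ for $E(X_{\zeta_k+1} \mid X_0^{\zeta_k})$. The error splits as
  $$g_k - V_k = \frac1k \sum_{j<k} (X_{\zeta_j+1} - V_j) + \Bigl(\frac1k \sum_{j<k} V_j - V_k\Bigr),$$
  and it suffices that the first average tends to $0$ and that $V_k$ converges.

  Everything rests on one invariance: the process seen from $\zeta_k$, that is
  $n \mapsto X_{\zeta_k+n}$, has the law of the original process (\<open>law_of_seen\<close>). Passing from
  $\zeta_{k-1}$ to $\zeta_k$ moves a path to the first time at which its current block recurs. For
  a measure preserving, invertible flow such a return map preserves the measure
  (\<open>return_map_preserves\<close>): ``the first return takes $t$ steps'' is, seen from the place of arrival,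
  ``the first return in backward time takes $t$ steps'', and by Poincare recurrence the backward
  returns exhaust the space.

  The first average: $X_{\zeta_j+1} - V_j$ are martingale differences for the stopped
  $\sigma$-algebras, because $\zeta_j + 1 \le \zeta_{j+1}$, and by invariance they are bounded in
  $L^2$. Orthogonality and bounded second moments already give the strong law
  (\<open>martingale_difference_strong_law\<close>).

  Convergence of $V_k$: as soon as $l_{k+1} > i$, the coordinate $X_{\zeta_k-i}$ stays in the same
  cell of $\mathcal P_{k+1}$ when $\zeta_k$ is replaced by $\zeta_{k+1}$, and by invariance these cells shrink in
  probability, hence almost surely, since they are nested. So the pasts seen from $\zeta_k$
  converge coordinatewise to a random sequence, which lies in the continuity set $C$
  because, for every $k$, the past at $\zeta_k$ lies in a given compact subset of $C$ with the same
  probability, close to $1$ for large subsets (\<open>AE_limit_in_support\<close>). Let $f$ be the version of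
  the conditional expectation that is continuous on $C$. Then $V_k$ is the average of $f$, given $X_0^{\zeta_k}$, over the unseen remote
  past. The metric $d^*$ sees only finitely many coordinates up to a given error, so $f$ is within
  $\varepsilon$ of its value at the limit on a neighbourhood that involves finitely many coordinates.
  Whether the past lies in it is eventually decided by $X_0^{\zeta_k}$, and then $V_k$, an average of
  values of $f$ on this neighbourhood, is within $\varepsilon$ of the same value, whatever the
  size of $f$ elsewhere (\<open>AE_cond_next_converges\<close>).\<close>

section \<open>A strong law for martingale differences\<close>

text \<open>The sum of the squares has finite expectation, so it is almost everywhere a convergent series.\<close>

lemma AE_tendsto_zero_if_summable_second_moments:
  fixes Z :: "nat \<Rightarrow> 'a \<Rightarrow> real"
  assumes int: "\<And>n. integrable M (\<lambda>x. (Z n x)\<^sup>2)"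
    and sm: "summable (\<lambda>n. \<integral>x. (Z n x)\<^sup>2 \<partial>M)"
  shows "AE x in M. (\<lambda>n. Z n x) \<longlonglongrightarrow> 0"
proof -
  have [measurable]: "(\<lambda>x. (Z n x)\<^sup>2) \<in> borel_measurable M" for n
    using int by auto
  have "(\<integral>\<^sup>+x. (\<Sum>n. ennreal ((Z n x)\<^sup>2)) \<partial>M) = (\<Sum>n. \<integral>\<^sup>+x. ennreal ((Z n x)\<^sup>2) \<partial>M)"
    by (rule nn_integral_suminf) measurable
  also have "\<dots> = (\<Sum>n. ennreal (\<integral>x. (Z n x)\<^sup>2 \<partial>M))"
    by (simp add: nn_integral_eq_integral int)
  also have "\<dots> = ennreal (\<Sum>n. \<integral>x. (Z n x)\<^sup>2 \<partial>M)"
    by (rule suminf_ennreal2[OF _ sm]) simp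
  finally have "(\<integral>\<^sup>+x. (\<Sum>n. ennreal ((Z n x)\<^sup>2)) \<partial>M) \<noteq> \<infinity>"
    by simp
  then have "AE x in M. (\<Sum>n. ennreal ((Z n x)\<^sup>2)) \<noteq> \<infinity>"
    by (intro nn_integral_PInf_AE) auto
  then show ?thesis
  proof eventually_elim
    case (elim x)
    then have "summable (\<lambda>n. (Z n x)\<^sup>2)"
      by (intro summable_suminf_not_top) auto
    then have "(\<lambda>n. (Z n x)\<^sup>2) \<longlonglongrightarrow> 0"
      by (rule summable_LIMSEQ_zero)
    then show ?case by simp
  qed
qed

lemma square_sum_abs_le_card:
  fixes a :: "'b \<Rightarrow> real"
  shows "(\<Sum>i\<in>I. \<bar>a i\<bar>)\<^sup>2 \<le> real (card I) * (\<Sum>i\<in>I. (a i)\<^sup>2)"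
  using Cauchy_Schwarz_ineq_sum[of "\<lambda>_. 1" "\<lambda>i. \<bar>a i\<bar>" I] by simp

text \<open>The partial sums have variance of order $n$, so along the squares $n = m^2$ the averages have summable
  second moments. Between $m^2$ and $(m+1)^2$ there are only $2m+1$ terms, and by the Cauchy-Schwarz
  inequality the sum of their absolute values, divided by $m^2$, has second moment of order
  $m^{-2}$ too.\<close>

theorem orthogonal_strong_law:
  fixes D :: "nat \<Rightarrow> 'a \<Rightarrow> real"
  assumes meas [measurable]: "\<And>i. D i \<in> borel_measurable M"
    and sq: "\<And>i. integrable M (\<lambda>x. (D i x)\<^sup>2)"
    and bd: "\<And>i. (\<integral>x. (D i x)\<^sup>2 \<partial>M) \<le> K"
    and prod: "\<And>i j. i < j \<Longrightarrow> integrable M (\<lambda>x. D i x * D j x)"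
    and orth: "\<And>i j. i < j \<Longrightarrow> (\<integral>x. D i x * D j x \<partial>M) = 0"
  shows "AE x in M. (\<lambda>n. (\<Sum>j<n. D j x) / real n) \<longlonglongrightarrow> 0"
proof -
  define S where "S n x = (\<Sum>j<n. D j x)" for n x
  define B where "B n x = (\<Sum>j\<in>{n\<^sup>2..<(Suc n)\<^sup>2}. \<bar>D j x\<bar>)" for n x
  have "0 \<le> (\<integral>x. (D 0 x)\<^sup>2 \<partial>M)" by simp
  with bd[of 0] have K: "0 \<le> K" by linarith
  have S2: "integrable M (\<lambda>x. (S n x)\<^sup>2) \<and> (\<integral>x. (S n x)\<^sup>2 \<partial>M) = (\<Sum>j<n. \<integral>x. (D j x)\<^sup>2 \<partial>M)" for n
  proof (induction n)
    case 0 then show ?case by (simp add: S_def)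
  next
    case (Suc n)
    have cross: "integrable M (\<lambda>x. S n x * D n x)" "(\<integral>x. S n x * D n x \<partial>M) = 0"
      unfolding S_def sum_distrib_right using prod orth
      by (auto simp: Bochner_Integration.integral_sum)
    have eq: "(S (Suc n) x)\<^sup>2 = (S n x)\<^sup>2 + 2 * (S n x * D n x) + (D n x)\<^sup>2" for x
      by (simp add: S_def power2_eq_square algebra_simps)
    show ?case unfolding eq using Suc cross sq by simp
  qed
  have S_le: "(\<integral>x. (S n x)\<^sup>2 \<partial>M) \<le> real n * K" for n
    using S2[of n] sum_bounded_above[of "{..<n}" "\<lambda>j. \<integral>x. (D j x)\<^sup>2 \<partial>M" K] bd by simp
  have card: "card {n\<^sup>2..<(Suc n)\<^sup>2} = 2 * n + 1" for n :: nat
    by (simp add: power2_eq_square algebra_simps)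
  have B_le: "(B n x)\<^sup>2 \<le> real (2 * n + 1) * (\<Sum>j\<in>{n\<^sup>2..<(Suc n)\<^sup>2}. (D j x)\<^sup>2)" for n x
    using square_sum_abs_le_card[of "\<lambda>j. D j x" "{n\<^sup>2..<(Suc n)\<^sup>2}"] unfolding B_def card .
  have [measurable]: "B n \<in> borel_measurable M" for n
    unfolding B_def by measurable
  have B_int: "integrable M (\<lambda>x. (B n x)\<^sup>2)" for n
    by (rule Bochner_Integration.integrable_bound
        [where f = "\<lambda>x. real (2 * n + 1) * (\<Sum>j\<in>{n\<^sup>2..<(Suc n)\<^sup>2}. (D j x)\<^sup>2)"])
      (use sq B_le in \<open>auto simp: sum_nonneg\<close>)
  have B2: "(\<integral>x. (B n x)\<^sup>2 \<partial>M) \<le> (real (2 * n + 1))\<^sup>2 * K" for n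
  proof -
    have "(\<integral>x. (B n x)\<^sup>2 \<partial>M) \<le> (\<integral>x. real (2 * n + 1) * (\<Sum>j\<in>{n\<^sup>2..<(Suc n)\<^sup>2}. (D j x)\<^sup>2) \<partial>M)"
      by (rule integral_mono[OF B_int _ B_le]) (use sq in auto)
    also have "\<dots> = real (2 * n + 1) * (\<Sum>j\<in>{n\<^sup>2..<(Suc n)\<^sup>2}. \<integral>x. (D j x)\<^sup>2 \<partial>M)"
      using sq by (simp add: Bochner_Integration.integral_sum)
    also have "\<dots> \<le> real (2 * n + 1) * (real (2 * n + 1) * K)"
      using sum_bounded_above[of "{n\<^sup>2..<(Suc n)\<^sup>2}" "\<lambda>j. \<integral>x. (D j x)\<^sup>2 \<partial>M" K] bd
      unfolding card by (intro mult_left_mono) auto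
    finally show ?thesis by (simp add: power2_eq_square mult.assoc)
  qed
  have sum_sq: "summable (\<lambda>n. 9 * K * inverse ((real n)\<^sup>2))"
    using inverse_power_summable[of 2, where 'a = real] by (intro summable_mult) simp
  have S0: "AE x in M. (\<lambda>n. S (n\<^sup>2) x / (real n)\<^sup>2) \<longlonglongrightarrow> 0"
  proof (rule AE_tendsto_zero_if_summable_second_moments)
    show "integrable M (\<lambda>x. (S (n\<^sup>2) x / (real n)\<^sup>2)\<^sup>2)" for n
      using S2[of "n\<^sup>2"] by (simp add: power_divide)
    show "summable (\<lambda>n. \<integral>x. (S (n\<^sup>2) x / (real n)\<^sup>2)\<^sup>2 \<partial>M)"
    proof (rule summable_comparison_test[OF _ sum_sq], intro exI allI impI)
      fix n :: nat
      have "(\<integral>x. (S (n\<^sup>2) x / (real n)\<^sup>2)\<^sup>2 \<partial>M) = (\<integral>x. (S (n\<^sup>2) x)\<^sup>2 \<partial>M) / ((real n)\<^sup>2)\<^sup>2"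
        by (simp add: power_divide)
      also have "\<dots> \<le> real (n\<^sup>2) * K / ((real n)\<^sup>2)\<^sup>2"
        by (intro divide_right_mono S_le) simp
      also have "\<dots> = K * inverse ((real n)\<^sup>2)"
        by (cases "n = 0") (auto simp: power2_eq_square field_simps)
      also have "\<dots> \<le> 9 * K * inverse ((real n)\<^sup>2)"
        using K by (intro mult_right_mono) auto
      finally show "norm (\<integral>x. (S (n\<^sup>2) x / (real n)\<^sup>2)\<^sup>2 \<partial>M) \<le> 9 * K * inverse ((real n)\<^sup>2)"
        by simp
    qed
  qed
  have B0: "AE x in M. (\<lambda>n. B n x / (real n)\<^sup>2) \<longlonglongrightarrow> 0"
  proof (rule AE_tendsto_zero_if_summable_second_moments)
    show "integrable M (\<lambda>x. (B n x / (real n)\<^sup>2)\<^sup>2)" for n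
      using B_int[of n] by (simp add: power_divide)
    show "summable (\<lambda>n. \<integral>x. (B n x / (real n)\<^sup>2)\<^sup>2 \<partial>M)"
    proof (rule summable_comparison_test[OF _ sum_sq], intro exI allI impI)
      fix n :: nat
      have "(\<integral>x. (B n x / (real n)\<^sup>2)\<^sup>2 \<partial>M) = (\<integral>x. (B n x)\<^sup>2 \<partial>M) / ((real n)\<^sup>2)\<^sup>2"
        by (simp add: power_divide)
      also have "\<dots> \<le> (real (2 * n + 1))\<^sup>2 * K / ((real n)\<^sup>2)\<^sup>2"
        by (intro divide_right_mono B2) simp
      also have "\<dots> \<le> 9 * K * inverse ((real n)\<^sup>2)"
      proof (cases "n = 0")
        case False
        have "(real (2 * n + 1))\<^sup>2 \<le> (3 * real n)\<^sup>2"
          using False by (intro power_mono) auto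
        then have "(real (2 * n + 1))\<^sup>2 * K / ((real n)\<^sup>2)\<^sup>2 \<le> (3 * real n)\<^sup>2 * K / ((real n)\<^sup>2)\<^sup>2"
          using K by (intro divide_right_mono mult_right_mono) auto
        also have "\<dots> = 9 * K * inverse ((real n)\<^sup>2)"
          using False by (simp add: power2_eq_square field_simps)
        finally show ?thesis .
      qed auto
      finally show "norm (\<integral>x. (B n x / (real n)\<^sup>2)\<^sup>2 \<partial>M) \<le> 9 * K * inverse ((real n)\<^sup>2)"
        by simp
    qed
  qed
  from S0 B0 show ?thesis
  proof eventually_elim
    case (elim x)
    have "filterlim floor_sqrt at_top sequentially"
      unfolding filterlim_at_top eventually_sequentially
    proof (intro allI exI impI)
      fix N n :: nat assume "N\<^sup>2 \<le> n"
      then show "N \<le> floor_sqrt n" by (simp add: le_floor_sqrtI)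
    qed
    from filterlim_compose[OF _ this, OF tendsto_add[OF tendsto_rabs[OF elim(1)] elim(2)]]
    have lim: "(\<lambda>m. \<bar>S ((floor_sqrt m)\<^sup>2) x / (real (floor_sqrt m))\<^sup>2\<bar>
        + B (floor_sqrt m) x / (real (floor_sqrt m))\<^sup>2) \<longlonglongrightarrow> 0"
      by simp
    show ?case
    proof (rule Lim_null_comparison[OF _ lim], rule eventually_sequentiallyI)
      fix m :: nat assume "1 \<le> m"
      define n where "n = floor_sqrt m"
      have n: "n\<^sup>2 \<le> m" "m < (Suc n)\<^sup>2"
        unfolding n_def by (simp_all add: Suc_floor_sqrt_power2_gt)
      have "0 < n" unfolding n_def using \<open>1 \<le> m\<close> by simp
      have "S m x = S (n\<^sup>2) x + (\<Sum>j\<in>{n\<^sup>2..<m}. D j x)"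
        unfolding S_def using n(1)
        by (metis atLeast0LessThan sum.atLeastLessThan_concat zero_le)
      moreover have "\<bar>\<Sum>j\<in>{n\<^sup>2..<m}. D j x\<bar> \<le> B n x"
        unfolding B_def using n(2)
        by (intro order_trans[OF sum_abs] sum_mono2) auto
      ultimately have "\<bar>S m x\<bar> \<le> \<bar>S (n\<^sup>2) x\<bar> + B n x" by linarith
      moreover have "0 \<le> B n x" by (simp add: B_def sum_nonneg)
      ultimately have "\<bar>S m x\<bar> / real m \<le> (\<bar>S (n\<^sup>2) x\<bar> + B n x) / real (n\<^sup>2)"
        using n(1) \<open>0 < n\<close> by (intro frac_le) auto
      then show "norm ((\<Sum>j<m. D j x) / real m) \<le> \<bar>S ((floor_sqrt m)\<^sup>2) x / (real (floor_sqrt m))\<^sup>2\<bar>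
        + B (floor_sqrt m) x / (real (floor_sqrt m))\<^sup>2"
        by (simp add: n_def S_def add_divide_distrib)
    qed
  qed
qed

lemma integrable_mult_of_squares:
  fixes f g :: "'a \<Rightarrow> real"
  assumes [measurable]: "f \<in> borel_measurable M" "g \<in> borel_measurable M"
    and "integrable M (\<lambda>x. (f x)\<^sup>2)" "integrable M (\<lambda>x. (g x)\<^sup>2)"
  shows "integrable M (\<lambda>x. f x * g x)"
proof (rule Bochner_Integration.integrable_bound)
  show "integrable M (\<lambda>x. (f x)\<^sup>2 + (g x)\<^sup>2)" using assms by simp
  show "AE x in M. norm (f x * g x) \<le> norm ((f x)\<^sup>2 + (g x)\<^sup>2)"
  proof (rule AE_I2)
    fix x
    have "2 * \<bar>f x\<bar> * \<bar>g x\<bar> \<le> (f x)\<^sup>2 + (g x)\<^sup>2"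
      using sum_squares_bound[of "\<bar>f x\<bar>" "\<bar>g x\<bar>"] by simp
    moreover have "0 \<le> \<bar>f x\<bar> * \<bar>g x\<bar>" by simp
    ultimately have "\<bar>f x\<bar> * \<bar>g x\<bar> \<le> (f x)\<^sup>2 + (g x)\<^sup>2" by linarith
    then show "norm (f x * g x) \<le> norm ((f x)\<^sup>2 + (g x)\<^sup>2)" by (simp add: abs_mult)
  qed
qed measurable

lemma (in prob_space) cond_exp_square:
  fixes f :: "'a \<Rightarrow> real"
  assumes "subalgebra M G" and [measurable]: "f \<in> borel_measurable M"
    and sq: "integrable M (\<lambda>x. (f x)\<^sup>2)"
  shows "integrable M (\<lambda>x. (real_cond_exp M G f x)\<^sup>2)"
    and "(\<integral>x. (real_cond_exp M G f x)\<^sup>2 \<partial>M) \<le> (\<integral>x. (f x)\<^sup>2 \<partial>M)"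
proof -
  interpret G: finite_measure_subalgebra M G
    by unfold_locales (rule assms(1))
  have f: "integrable M f" using integrable_mult_of_squares[of f M "\<lambda>_. 1"] sq by simp
  have q: "convex_on UNIV (\<lambda>t::real. t\<^sup>2)" by (rule convex_power2)
  show int: "integrable M (\<lambda>x. (real_cond_exp M G f x)\<^sup>2)"
    by (rule G.integrable_convex_cond_exp[where q = "\<lambda>t. t\<^sup>2" and I = UNIV]) (use f sq q in auto)
  have "AE x in M. (real_cond_exp M G f x)\<^sup>2 \<le> real_cond_exp M G (\<lambda>x. (f x)\<^sup>2) x"
    by (rule G.real_cond_exp_jensens_inequality(2)[where q = "\<lambda>t. t\<^sup>2" and I = UNIV]) (use f sq q in auto)
  then have "(\<integral>x. (real_cond_exp M G f x)\<^sup>2 \<partial>M) \<le> (\<integral>x. real_cond_exp M G (\<lambda>x. (f x)\<^sup>2) x \<partial>M)"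
    by (intro integral_mono_AE int G.real_cond_exp_int(1)[OF sq])
  also have "\<dots> = (\<integral>x. (f x)\<^sup>2 \<partial>M)" by (rule G.real_cond_exp_int(2)[OF sq])
  finally show "(\<integral>x. (real_cond_exp M G f x)\<^sup>2 \<partial>M) \<le> (\<integral>x. (f x)\<^sup>2 \<partial>M)" .
qed

text \<open>The differences are orthogonal: the earlier one is measurable with respect to the
  $\sigma$-algebra on which the later one is conditioned. Their second moments are controlled by
  those of $Y_k$ through Jensen's inequality.\<close>

theorem (in prob_space) martingale_difference_strong_law:
  fixes Y :: "nat \<Rightarrow> 'a \<Rightarrow> real"
  assumes G: "\<And>k. subalgebra M (G k)"
    and mono: "\<And>j k. j \<le> k \<Longrightarrow> sets (G j) \<subseteq> sets (G k)"
    and adapted: "\<And>j k. j < k \<Longrightarrow> Y j \<in> borel_measurable (G k)"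
    and sq: "\<And>k. integrable M (\<lambda>x. (Y k x)\<^sup>2)"
    and bd: "\<And>k. (\<integral>x. (Y k x)\<^sup>2 \<partial>M) \<le> K"
  shows "AE x in M. (\<lambda>n. (\<Sum>j<n. Y j x - real_cond_exp M (G j) (Y j) x) / real n) \<longlonglongrightarrow> 0"
proof -
  define V where "V k = real_cond_exp M (G k) (Y k)" for k
  define D where "D k x = Y k x - V k x" for k x
  have Y [measurable]: "Y k \<in> borel_measurable M" for k
    using measurable_from_subalg[OF G adapted[of k "Suc k"]] by simp
  have V [measurable]: "V k \<in> borel_measurable M" for k unfolding V_def by measurable
  have [measurable]: "D k \<in> borel_measurable M" for k unfolding D_def by measurable
  have D_adapted: "D j \<in> borel_measurable (G k)" if "j < k" for j k
  proof -
    have "subalgebra (G k) (G j)"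
      using G mono[of j k] that unfolding subalgebra_def by auto
    then have "V j \<in> borel_measurable (G k)"
      unfolding V_def by (rule measurable_from_subalg) measurable
    then show ?thesis using adapted[OF that] unfolding D_def by measurable
  qed
  have V2: "integrable M (\<lambda>x. (V k x)\<^sup>2)" "(\<integral>x. (V k x)\<^sup>2 \<partial>M) \<le> K" for k
    using cond_exp_square[OF G Y sq, of k k] bd[of k] unfolding V_def by auto
  have D_le: "(D k x)\<^sup>2 \<le> 2 * (Y k x)\<^sup>2 + 2 * (V k x)\<^sup>2" for k x
    using zero_le_power2[of "Y k x + V k x"] unfolding D_def by (simp add: power2_eq_square algebra_simps)
  have D2: "integrable M (\<lambda>x. (D k x)\<^sup>2)" for k
    by (rule Bochner_Integration.integrable_bound[where f = "\<lambda>x. 2 * (Y k x)\<^sup>2 + 2 * (V k x)\<^sup>2"])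
      (use sq V2 D_le in auto)
  have D2_le: "(\<integral>x. (D k x)\<^sup>2 \<partial>M) \<le> 4 * K" for k
  proof -
    have "(\<integral>x. (D k x)\<^sup>2 \<partial>M) \<le> (\<integral>x. 2 * (Y k x)\<^sup>2 + 2 * (V k x)\<^sup>2 \<partial>M)"
      by (rule integral_mono[OF D2 _ D_le]) (use sq V2 in auto)
    also have "\<dots> = 2 * (\<integral>x. (Y k x)\<^sup>2 \<partial>M) + 2 * (\<integral>x. (V k x)\<^sup>2 \<partial>M)"
      using sq V2 by simp
    also have "\<dots> \<le> 4 * K" using bd[of k] V2(2)[of k] by simp
    finally show ?thesis .
  qed
  have DD: "integrable M (\<lambda>x. D i x * D j x)" for i j
    by (rule integrable_mult_of_squares) (use D2 in auto)
  have orth: "(\<integral>x. D i x * D j x \<partial>M) = 0" if "i < j" for i j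
  proof -
    interpret G: finite_measure_subalgebra M "G j" by unfold_locales (rule G)
    have DY: "integrable M (\<lambda>x. D i x * Y j x)" by (rule integrable_mult_of_squares) (use D2 sq in auto)
    have "(\<integral>x. D i x * D j x \<partial>M) = (\<integral>x. D i x * Y j x - D i x * V j x \<partial>M)"
      unfolding D_def[of j] by (simp add: right_diff_distrib)
    also have "\<dots> = (\<integral>x. D i x * Y j x \<partial>M) - (\<integral>x. D i x * V j x \<partial>M)"
      unfolding V_def using G.real_cond_exp_intg(1)[OF DY D_adapted[OF that] Y] DY by simp
    also have "\<dots> = 0"
      unfolding V_def using G.real_cond_exp_intg(2)[OF DY D_adapted[OF that] Y] by simp
    finally show ?thesis .
  qed
  have "AE x in M. (\<lambda>n. (\<Sum>j<n. D j x) / real n) \<longlonglongrightarrow> 0"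
    by (rule orthogonal_strong_law[OF _ D2 D2_le DD orth]) measurable
  then show ?thesis by (simp add: D_def V_def)
qed

lemma tendsto_cesaro:
  fixes a :: "nat \<Rightarrow> real"
  assumes a: "a \<longlonglongrightarrow> L"
  shows "(\<lambda>n. (\<Sum>j<n. a j) / real n) \<longlonglongrightarrow> L"
proof (rule LIMSEQ_I)
  fix e :: real assume "0 < e"
  obtain N where N: "\<And>n. N \<le> n \<Longrightarrow> \<bar>a n - L\<bar> < e / 2"
    using LIMSEQ_D[OF a, of "e / 2"] \<open>0 < e\<close> by auto
  define K where "K = (\<Sum>j<N. \<bar>a j - L\<bar>)"
  have lim: "(\<lambda>n. K / real n) \<longlonglongrightarrow> 0" by (rule lim_const_over_n)
  obtain N' where N': "\<And>n. N' \<le> n \<Longrightarrow> \<bar>K / real n\<bar> < e / 2"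
    using LIMSEQ_D[OF lim, of "e / 2"] \<open>0 < e\<close> by auto
  show "\<exists>no. \<forall>n\<ge>no. norm ((\<Sum>j<n. a j) / real n - L) < e"
  proof (intro exI allI impI)
    fix n assume n: "Suc (max N N') \<le> n"
    have "(\<Sum>j<n. a j) / real n - L = (\<Sum>j<n. a j - L) / real n"
      using n by (simp add: sum_subtractf field_simps)
    also have "\<bar>\<dots>\<bar> \<le> (\<Sum>j<n. \<bar>a j - L\<bar>) / real n"
      by (simp add: divide_right_mono)
    also have "(\<Sum>j<n. \<bar>a j - L\<bar>) = K + (\<Sum>j\<in>{N..<n}. \<bar>a j - L\<bar>)"
    proof -
      have "{..<n} = {..<N} \<union> {N..<n}" using n by auto
      then show ?thesis unfolding K_def by (simp add: sum.union_disjoint ivl_disj_int)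
    qed
    also have "(\<Sum>j\<in>{N..<n}. \<bar>a j - L\<bar>) \<le> real n * (e / 2)"
    proof -
      have "(\<Sum>j\<in>{N..<n}. \<bar>a j - L\<bar>) \<le> real (card {N..<n}) * (e / 2)"
        by (rule sum_bounded_above) (use N in \<open>auto intro: less_imp_le\<close>)
      also have "\<dots> \<le> real n * (e / 2)" using \<open>0 < e\<close> by (intro mult_right_mono) auto
      finally show ?thesis .
    qed
    finally have "\<bar>(\<Sum>j<n. a j) / real n - L\<bar> \<le> (K + real n * (e / 2)) / real n"
      by (simp add: divide_right_mono)
    also have "\<dots> = K / real n + e / 2" using n by (simp add: add_divide_distrib)
    also have "\<dots> < e" using N'[of n] n by linarith
    finally show "norm ((\<Sum>j<n. a j) / real n - L) < e" by simp
  qed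
qed

section \<open>Bounding a conditional expectation on an event\<close>

text \<open>The function \<open>g\<close> stands for an integrand with the same conditional expectation as \<open>f\<close>, but
  for which the bounds hold on \<open>S\<close> pointwise. Since \<open>S\<close> belongs to \<open>G\<close>, the indicator of \<open>S\<close> can be
  taken inside the conditional expectation, which then only averages values of \<open>g\<close> on \<open>S\<close>.\<close>

lemma (in prob_space) cond_exp_bounds_on:
  fixes f g :: "'a \<Rightarrow> real"
  assumes "subalgebra M G"
    and f: "integrable M f" and g: "integrable M g"
    and eq: "\<And>A. A \<in> sets G \<Longrightarrow> (\<integral>x\<in>A. f x \<partial>M) = (\<integral>x\<in>A. g x \<partial>M)"
    and S: "S \<in> sets G"
    and bd: "AE x in M. x \<in> S \<longrightarrow> a \<le> g x \<and> g x \<le> b"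
  shows "AE x in M. x \<in> S \<longrightarrow> a \<le> real_cond_exp M G f x \<and> real_cond_exp M G f x \<le> b"
proof -
  interpret G: finite_measure_subalgebra M G
    by unfold_locales (rule assms(1))
  have [measurable]: "S \<in> sets M" "S \<in> sets G"
    using S assms(1) by (auto simp: subalgebra_def)
  have [measurable]: "g \<in> borel_measurable M" using g by simp
  have Sg: "integrable M (\<lambda>x. indicator S x * g x)"
    using integrable_mult_indicator[OF \<open>S \<in> sets M\<close> g] by simp
  have c: "integrable M (\<lambda>x. indicator S x * c)" for c :: real
    by (intro integrable_mult_left integrable_real_indicator) (auto simp: emeasure_eq_measure)
  have 1: "AE x in M. real_cond_exp M G f x = real_cond_exp M G g x"
  proof (rule G.real_cond_exp_charact)
    show "(\<integral>x\<in>A. f x \<partial>M) = (\<integral>x\<in>A. real_cond_exp M G g x \<partial>M)" if "A \<in> sets G" for A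
      using eq[OF that] G.real_cond_exp_intA[OF g that] by simp
  qed (use f g in auto)
  have 2: "AE x in M. real_cond_exp M G (\<lambda>x. indicator S x * g x) x = indicator S x * real_cond_exp M G g x"
    by (rule G.real_cond_exp_mult[OF _ _ Sg]) measurable
  have 3: "AE x in M. real_cond_exp M G (\<lambda>x. indicator S x * c) x = indicator S x * c" for c :: real
    by (rule G.real_cond_exp_F_meas[OF c]) measurable
  have 4: "AE x in M. real_cond_exp M G (\<lambda>x. indicator S x * a) x \<le> real_cond_exp M G (\<lambda>x. indicator S x * g x) x"
    by (rule G.real_cond_exp_mono[OF _ c Sg]) (use bd in \<open>auto simp: indicator_def elim!: eventually_mono\<close>)
  have 5: "AE x in M. real_cond_exp M G (\<lambda>x. indicator S x * g x) x \<le> real_cond_exp M G (\<lambda>x. indicator S x * b) x"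
    by (rule G.real_cond_exp_mono[OF _ Sg c]) (use bd in \<open>auto simp: indicator_def elim!: eventually_mono\<close>)
  from 1 2 3[of a] 3[of b] 4 5 show ?thesis
    by eventually_elim (auto simp: indicator_def split: if_splits)
qed

section \<open>Return maps preserve the measure\<close>

text \<open>The convention for the empty set is that of \<^const>\<open>recurrence\<close>: the value is \<open>\<infinity>\<close> if \<open>p\<close> never
  holds at a positive time.\<close>

definition first_time :: "(nat \<Rightarrow> bool) \<Rightarrow> enat" where
  "first_time p = Inf {enat t | t. 0 < t \<and> p t}"

lemma first_time_eq_enat_iff:
  "first_time p = enat t \<longleftrightarrow> 0 < t \<and> p t \<and> (\<forall>s. 0 < s \<and> s < t \<longrightarrow> \<not> p s)"
proof
  assume eq: "first_time p = enat t"
  have ne: "{enat t | t. 0 < t \<and> p t} \<noteq> {}"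
    using eq unfolding first_time_def by (metis Inf_empty infinity_ne_i1 enat.distinct(1) top_enat_def)
  have "first_time p \<in> {enat t | t. 0 < t \<and> p t}"
    unfolding first_time_def Inf_enat_def using ne by (auto intro: LeastI)
  then have "0 < t" "p t" using eq by auto
  moreover have "\<not> p s" if "0 < s" "s < t" for s
  proof
    assume "p s"
    then have "first_time p \<le> enat s"
      unfolding first_time_def using that by (intro Inf_lower) auto
    then show False using eq that by simp
  qed
  ultimately show "0 < t \<and> p t \<and> (\<forall>s. 0 < s \<and> s < t \<longrightarrow> \<not> p s)" by blast
next
  assume *: "0 < t \<and> p t \<and> (\<forall>s. 0 < s \<and> s < t \<longrightarrow> \<not> p s)"
  show "first_time p = enat t"
    unfolding first_time_def
  proof (rule antisym)
    show "Inf {enat t | t. 0 < t \<and> p t} \<le> enat t" using * by (intro Inf_lower) auto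
    show "enat t \<le> Inf {enat t | t. 0 < t \<and> p t}"
      using * by (intro Inf_greatest) (auto simp: not_less[symmetric])
  qed
qed

lemma first_time_finite_iff: "(\<exists>t. first_time p = enat t) \<longleftrightarrow> (\<exists>t>0. p t)"
proof
  assume "\<exists>t>0. p t"
  then have ex: "\<exists>t. 0 < t \<and> p t" by blast
  show "\<exists>t. first_time p = enat t"
    unfolding first_time_eq_enat_iff
    using LeastI_ex[OF ex] not_less_Least[of _ "\<lambda>t. 0 < t \<and> p t"] by blast
qed (auto simp: first_time_eq_enat_iff)

lemma first_time_positive: "0 < first_time p"
proof (cases "first_time p")
  case (enat t)
  then show ?thesis using first_time_eq_enat_iff[of p t] by (simp add: zero_enat_def)
qed (simp add: zero_enat_def)

lemma measurable_first_time:
  assumes "\<And>t. Measurable.pred M (\<lambda>x. p x t)"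
  shows "(\<lambda>x. first_time (p x)) \<in> M \<rightarrow>\<^sub>M count_space UNIV"
proof -
  have *: "{x \<in> space M. first_time (p x) = enat t} \<in> sets M" for t
    unfolding first_time_eq_enat_iff using assms by measurable
  have "{x \<in> space M. first_time (p x) = c} \<in> sets M" for c
  proof (cases c)
    case infinity
    have "{x \<in> space M. first_time (p x) = c} = space M - (\<Union>t. {x \<in> space M. first_time (p x) = enat t})"
      unfolding infinity by (auto simp: not_infinity_eq)
    then show ?thesis using * by auto
  qed (use * in auto)
  then show ?thesis
    by (subst measurable_count_space_eq2_countable) (auto simp: vimage_def Int_def conj_commute)
qed

lemma pred_eq_count_space:
  assumes L: "countable L"
    and f: "f \<in> M \<rightarrow>\<^sub>M count_space L" and g: "g \<in> M \<rightarrow>\<^sub>M count_space L"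
  shows "Measurable.pred M (\<lambda>x. f x = g x)"
proof -
  have "{x \<in> space M. f x = g x} = (\<Union>w\<in>L. (f -` {w} \<inter> space M) \<inter> (g -` {w} \<inter> space M))"
    using measurable_space[OF f] measurable_space[OF g] by (auto simp: space_count_space)
  also have "\<dots> \<in> sets M"
    using measurable_sets[OF f] measurable_sets[OF g]
    by (intro sets.countable_UN'[OF L]) auto
  finally show ?thesis by (simp add: pred_def)
qed

text \<open>The measures of disjoint sets are summable, and a summable constant sequence vanishes.\<close>

lemma measure_zero_if_disjoint_copies:
  fixes A :: "nat \<Rightarrow> 'b set"
  assumes "finite_measure N" "range A \<subseteq> sets N" "disjoint_family A" "\<And>n. measure N (A n) = c"
  shows "c = 0"
proof -
  interpret finite_measure N by fact
  have "(\<lambda>n. c) sums measure N (\<Union>n. A n)"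
    using finite_measure_UNION[OF assms(2,3)] assms(4) by simp
  then have "(\<lambda>n. c) \<longlonglongrightarrow> 0" by (intro summable_LIMSEQ_zero) (rule sums_summable)
  then show ?thesis by (simp add: LIMSEQ_const_iff)
qed

text \<open>With \<open>\<lambda>h. T (- h)\<close> in place of \<open>T\<close> this is the return time in backward time.\<close>

definition return_time :: "(int \<Rightarrow> 'b \<Rightarrow> 'b) \<Rightarrow> ('b \<Rightarrow> 'c) \<Rightarrow> 'b \<Rightarrow> enat" where
  "return_time T b x = first_time (\<lambda>t. b (T (int t) x) = b x)"

locale measure_preserving_flow = prob_space N for N :: "'b measure" +
  fixes T :: "int \<Rightarrow> 'b \<Rightarrow> 'b"
  assumes T_measurable [measurable]: "\<And>h. T h \<in> N \<rightarrow>\<^sub>M N"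
    and T_preserving: "\<And>h. distr N N (T h) = N"
    and T_add: "\<And>h k x. x \<in> space N \<Longrightarrow> T h (T k x) = T (h + k) x"
    and T_zero: "\<And>x. x \<in> space N \<Longrightarrow> T 0 x = x"
begin

lemma T_space: "x \<in> space N \<Longrightarrow> T h x \<in> space N"
  by (rule measurable_space[OF T_measurable])

lemma emeasure_T_vimage:
  assumes "A \<in> sets N"
  shows "emeasure N {x \<in> space N. T h x \<in> A} = emeasure N A"
proof -
  have "emeasure N A = emeasure (distr N N (T h)) A" by (simp add: T_preserving)
  also have "\<dots> = emeasure N {x \<in> space N. T h x \<in> A}"
    using assms by (simp add: emeasure_distr vimage_def Int_def conj_commute)
  finally show ?thesis by simp
qed

context
  fixes b :: "'b \<Rightarrow> 'c" and L :: "'c set"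
  assumes L: "countable L"
    and b [measurable]: "b \<in> N \<rightarrow>\<^sub>M count_space L"
begin

abbreviation (input) "ret \<equiv> return_time T b"
abbreviation (input) "bwd \<equiv> return_time (\<lambda>h. T (- h)) b"

lemma pred_label:
  assumes "w \<in> L"
  shows "Measurable.pred N (\<lambda>x. b (T i x) = w)"
proof -
  have "b -` {w} \<inter> space N \<in> sets N"
    by (rule measurable_sets[OF b]) (simp add: assms)
  then have "Measurable.pred N (\<lambda>x. b x = w)"
    by (simp add: pred_def vimage_def Int_def conj_commute)
  from measurable_compose[OF T_measurable this] show ?thesis .
qed

lemma pred_label_eq: "Measurable.pred N (\<lambda>x. b (T i x) = b (T j x))"
  by (rule pred_eq_count_space[OF L]) (rule measurable_compose[OF T_measurable b])+

lemma pred_label_recurs: "Measurable.pred N (\<lambda>x. b (T i x) = b x)"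
proof -
  have "{x \<in> space N. b (T i x) = b x} = {x \<in> space N. b (T i x) = b (T 0 x)}"
    by (auto simp: T_zero)
  then show ?thesis using pred_label_eq[of i 0] by (simp add: pred_def)
qed

text \<open>Poincare recurrence. The points that carry the label \<open>w\<close> and never carried it before form a set
  whose translates are disjoint: if two iterates of a point fell into it, the later one
  would have carried \<open>w\<close> before. All translates have the same measure, so it is null, and
  there are countably many labels.\<close>

lemma AE_backward_recurrence: "AE x in N. \<exists>t>0. b (T (- int t) x) = b x"
proof -
  define W where "W w = {x \<in> space N. b x = w \<and> (\<forall>t>0. b (T (- int t) x) \<noteq> w)}" for w
  have W [measurable]: "W w \<in> sets N" if "w \<in> L" for w
  proof -
    have "W w = {x \<in> space N. b (T 0 x) = w \<and> (\<forall>t\<in>{0<..}. b (T (- int t) x) \<noteq> w)}"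
      by (auto simp: W_def T_zero)
    also have "\<dots> \<in> sets N"
      unfolding pred_def[symmetric]
      using that by (intro pred_intros_logic(2,3) measurable_pred_countable(1) pred_label) auto
    finally show ?thesis .
  qed
  have "AE x in N. x \<notin> W w" if w: "w \<in> L" for w
  proof -
    note [measurable] = W[OF w]
    have "measure N (W w) = 0"
    proof (rule measure_zero_if_disjoint_copies)
      show "finite_measure N" by unfold_locales
      show "range (\<lambda>j. {x \<in> space N. T (int j) x \<in> W w}) \<subseteq> sets N" by auto
      show "measure N {x \<in> space N. T (int j) x \<in> W w} = measure N (W w)" for j
        using emeasure_T_vimage[OF W[OF w], of "int j"] by (simp add: measure_def)
      have "False" if "i < j" "x \<in> space N" "T (int i) x \<in> W w" "T (int j) x \<in> W w" for i j x
      proof -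
        have "T (- int (j - i)) (T (int j) x) = T (int i) x"
          using that by (simp add: T_add of_nat_diff)
        then have "b (T (- int (j - i)) (T (int j) x)) = w" using that(3) by (simp add: W_def)
        then show False using that(1,4) unfolding W_def by (metis (mono_tags, lifting) mem_Collect_eq zero_less_diff)
      qed
      then show "disjoint_family (\<lambda>j. {x \<in> space N. T (int j) x \<in> W w})"
        unfolding disjoint_family_on_def by (auto, metis linorder_neqE_nat)
    qed
    then show ?thesis using W[OF w] by (intro AE_not_in) (auto simp: null_sets_def emeasure_eq_measure)
  qed
  then have "AE x in N. \<forall>w\<in>L. x \<notin> W w" using L by (simp add: AE_ball_countable)
  then show ?thesis
    using AE_space
  proof eventually_elim
    case (elim x)
    then show ?case using measurable_space[OF b, of x] by (auto simp: W_def)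
  qed
qed

lemma measurable_return_time [measurable]: "ret \<in> N \<rightarrow>\<^sub>M count_space UNIV"
  unfolding return_time_def[abs_def] by (intro measurable_first_time pred_label_recurs)

lemma measurable_backward_return_time [measurable]: "bwd \<in> N \<rightarrow>\<^sub>M count_space UNIV"
  unfolding return_time_def[abs_def] by (intro measurable_first_time pred_label_recurs)

text \<open>Time reversal: an excursion between two consecutive visits to a label looks the same from
  either end.\<close>

lemma return_eq_iff_backward_return_eq:
  assumes x: "x \<in> space N"
  shows "ret x = enat t \<longleftrightarrow> bwd (T (int t) x) = enat t"
proof -
  have rewind: "T (- int s) (T (int t) x) = T (int (t - s)) x" if "s \<le> t" for s
    using x that by (simp add: T_add of_nat_diff)
  have swap: "(\<forall>s. 0 < s \<and> s < t \<longrightarrow> Q s) \<longleftrightarrow> (\<forall>s. 0 < s \<and> s < t \<longrightarrow> Q (t - s))" for Q :: "nat \<Rightarrow> bool"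
  proof safe
    fix s assume "\<forall>s. 0 < s \<and> s < t \<longrightarrow> Q (t - s)" "0 < s" "s < t"
    then show "Q s" by (auto dest: spec[of _ "t - s"])
  qed auto
  show ?thesis
    unfolding return_time_def first_time_eq_enat_iff
    using T_zero[OF x] by (subst swap) (auto simp: rewind)
qed

text \<open>Decompose by the value \<open>t\<close> of the return time and shift each piece by \<open>t\<close>; the pieces become the
  level sets of the backward return time, which almost surely is finite.\<close>

lemma return_map_vimage:
  assumes A: "A \<in> sets N"
  shows "emeasure N {x \<in> space N. \<exists>t. ret x = enat t \<and> T (int t) x \<in> A} = emeasure N A"
proof -
  note [measurable] = A
  have "{x \<in> space N. \<exists>t. ret x = enat t \<and> T (int t) x \<in> A}
      = (\<Union>t. {x \<in> space N. T (int t) x \<in> {y \<in> space N. bwd y = enat t \<and> y \<in> A}})"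
    using T_space by (auto simp: return_eq_iff_backward_return_eq)
  also have "emeasure N \<dots> = (\<Sum>t. emeasure N {x \<in> space N. T (int t) x \<in> {y \<in> space N. bwd y = enat t \<and> y \<in> A}})"
  proof (rule suminf_emeasure[symmetric])
    show "disjoint_family (\<lambda>t. {x \<in> space N. T (int t) x \<in> {y \<in> space N. bwd y = enat t \<and> y \<in> A}})"
      unfolding disjoint_family_on_def by (auto simp flip: return_eq_iff_backward_return_eq)
  qed auto
  also have "\<dots> = (\<Sum>t. emeasure N {y \<in> space N. bwd y = enat t \<and> y \<in> A})"
    by (subst emeasure_T_vimage) auto
  also have "\<dots> = emeasure N (\<Union>t. {y \<in> space N. bwd y = enat t \<and> y \<in> A})"
    by (rule suminf_emeasure) (auto simp: disjoint_family_on_def)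
  also have "\<dots> = emeasure N A"
  proof (rule emeasure_eq_AE)
    show "AE x in N. x \<in> (\<Union>t. {y \<in> space N. bwd y = enat t \<and> y \<in> A}) \<longleftrightarrow> x \<in> A"
      using AE_backward_recurrence AE_space
    proof eventually_elim
      case (elim x)
      then show ?case using first_time_finite_iff[of "\<lambda>t. b (T (- int t) x) = b x"] by (auto simp: return_time_def)
    qed
  qed auto
  finally show ?thesis .
qed

text \<open>The preceding lemma, applied to the whole space, gives the set of returning points full mass.\<close>

lemma AE_recurrence: "AE x in N. ret x \<noteq> \<infinity>"
proof -
  have "emeasure N {x \<in> space N. \<exists>t. ret x = enat t \<and> T (int t) x \<in> space N} = 1"
    using return_map_vimage[of "space N"] by (simp add: emeasure_space_1)
  then have "AE x in N. x \<in> {x \<in> space N. \<exists>t. ret x = enat t \<and> T (int t) x \<in> space N}"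
    by (intro AE_prob_1) (simp add: measure_def)
  then show ?thesis by eventually_elim auto
qed

lemma measurable_return_map [measurable]: "(\<lambda>x. T (int (the_enat (ret x))) x) \<in> N \<rightarrow>\<^sub>M N"
  by (rule measurable_compose_countable[where f = "\<lambda>t x. T (int (the_enat t)) x" and g = ret]) auto

lemma return_map_preserves: "distr N N (\<lambda>x. T (int (the_enat (ret x))) x) = N"
proof (rule measure_eqI)
  fix A assume "A \<in> sets (distr N N (\<lambda>x. T (int (the_enat (ret x))) x))"
  then have [measurable]: "A \<in> sets N" by simp
  have "emeasure (distr N N (\<lambda>x. T (int (the_enat (ret x))) x)) A
      = emeasure N {x \<in> space N. T (int (the_enat (ret x))) x \<in> A}"
    by (simp add: emeasure_distr vimage_def Int_def conj_commute)
  also have "\<dots> = emeasure N {x \<in> space N. \<exists>t. ret x = enat t \<and> T (int t) x \<in> A}"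
    by (rule emeasure_eq_AE) (use AE_recurrence in \<open>auto elim!: eventually_mono\<close>)
  also have "\<dots> = emeasure N A" by (rule return_map_vimage) simp
  finally show "emeasure (distr N N (\<lambda>x. T (int (the_enat (ret x))) x)) A = emeasure N A" .
qed simp

end

end

section \<open>Paths, cells and blocks\<close>

abbreviation path_space :: "(int \<Rightarrow> real) measure" where
  "path_space \<equiv> \<Pi>\<^sub>M i\<in>UNIV. borel"

definition time_shift :: "int \<Rightarrow> (int \<Rightarrow> real) \<Rightarrow> int \<Rightarrow> real" where
  "time_shift h x = (\<lambda>i. x (i + h))"

lemma time_shift_add [simp]: "time_shift h (time_shift k x) = time_shift (h + k) x"
  by (simp add: time_shift_def fun_eq_iff algebra_simps)

lemma time_shift_zero [simp]: "time_shift 0 x = x"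
  by (simp add: time_shift_def)

lemma measurable_time_shift [measurable]: "time_shift h \<in> path_space \<rightarrow>\<^sub>M path_space"
  unfolding time_shift_def[abs_def] by (rule measurable_PiM_single') (auto simp: space_PiM)

lemma measurable_path:
  assumes "\<And>n. X n \<in> borel_measurable M"
  shows "(\<lambda>\<omega> n. X n \<omega>) \<in> M \<rightarrow>\<^sub>M path_space"
  by (rule measurable_PiM_single') (use assms in \<open>auto simp: space_PiM\<close>)

text \<open>The law lives on two-sided paths, on which the shifts form a group. This is where the two-sided
  time index matters: on one-sided paths there is no backward return time.\<close>

lemma flow_of_stationary:
  assumes "prob_space M" and X: "\<And>n. X n \<in> borel_measurable M" and st: "stationary M X"
  shows "measure_preserving_flow (distr M path_space (\<lambda>\<omega> n. X n \<omega>)) time_shift"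
proof -
  interpret prob_space M by fact
  note [measurable] = measurable_path[where X = X, OF X]
  interpret N: prob_space "distr M path_space (\<lambda>\<omega> n. X n \<omega>)"
    by (rule prob_space_distr) measurable
  show ?thesis
  proof
    fix h
    show "time_shift h \<in> distr M path_space (\<lambda>\<omega> n. X n \<omega>) \<rightarrow>\<^sub>M distr M path_space (\<lambda>\<omega> n. X n \<omega>)"
      by simp
    have "distr (distr M path_space (\<lambda>\<omega> n. X n \<omega>)) (distr M path_space (\<lambda>\<omega> n. X n \<omega>)) (time_shift h)
        = distr (distr M path_space (\<lambda>\<omega> n. X n \<omega>)) path_space (time_shift h)"
      by (rule distr_cong) auto
    also have "\<dots> = distr M path_space (\<lambda>\<omega> i. X (i + h) \<omega>)"
      by (subst distr_distr) (auto simp: comp_def time_shift_def)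
    also have "\<dots> = distr M path_space (\<lambda>\<omega> n. X n \<omega>)"
      using st by (simp add: stationary_def)
    finally show "distr (distr M path_space (\<lambda>\<omega> n. X n \<omega>)) (distr M path_space (\<lambda>\<omega> n. X n \<omega>)) (time_shift h)
        = distr M path_space (\<lambda>\<omega> n. X n \<omega>)" .
  qed auto
qed

lemma quantized_block_shift:
  "quantized_block Q (time_shift h x) m n = quantized_block Q x (m + h) (n + h)"
  unfolding quantized_block_def time_shift_def
  by (rule nth_equalityI) (auto simp: algebra_simps)

text \<open>Counting positions from the right end of the blocks, where the current time is.\<close>

lemma quantized_block_eq_iff:
  assumes "n - m = n' - m'"
  shows "quantized_block Q x m n = quantized_block Q y m' n' \<longleftrightarrow>
    (\<forall>i. int i \<le> n - m \<longrightarrow> cell Q (x (n - int i)) = cell Q (y (n' - int i)))"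
proof -
  have "quantized_block Q x m n = quantized_block Q y m' n' \<longleftrightarrow>
      (\<forall>j. int j < n - m + 1 \<longrightarrow> cell Q (x (m + int j)) = cell Q (y (m' + int j)))"
    using assms by (auto simp: quantized_block_def list_eq_iff_nth_eq)
  also have "\<dots> \<longleftrightarrow> (\<forall>i. int i \<le> n - m \<longrightarrow> cell Q (x (n - int i)) = cell Q (y (n' - int i)))"
  proof (intro iffI allI impI)
    fix i assume *: "\<forall>j. int j < n - m + 1 \<longrightarrow> cell Q (x (m + int j)) = cell Q (y (m' + int j))"
      and "int i \<le> n - m"
    define j where "j = nat (n - m - int i)"
    have eq: "m + int j = n - int i" "m' + int j = n' - int i" and lt: "int j < n - m + 1"
      using \<open>int i \<le> n - m\<close> assms by (auto simp: j_def)
    from mp[OF spec[OF *, of j] lt] show "cell Q (x (n - int i)) = cell Q (y (n' - int i))"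
      unfolding eq .
  next
    fix j assume *: "\<forall>i. int i \<le> n - m \<longrightarrow> cell Q (x (n - int i)) = cell Q (y (n' - int i))"
      and "int j < n - m + 1"
    define i where "i = nat (n - m - int j)"
    have eq: "n - int i = m + int j" "n' - int i = m' + int j" and le: "int i \<le> n - m"
      using \<open>int j < n - m + 1\<close> assms by (auto simp: i_def)
    from mp[OF spec[OF *, of i] le] show "cell Q (x (m + int j)) = cell Q (y (m' + int j))"
      unfolding eq .
  qed
  finally show ?thesis .
qed

lemma
  assumes "partition_on UNIV Q"
  shows cell_in_partition: "cell Q x \<in> Q"
    and mem_cell: "x \<in> cell Q x"
    and cell_eq_iff: "I \<in> Q \<Longrightarrow> cell Q x = I \<longleftrightarrow> x \<in> I"
proof -
  have ex1: "\<exists>!I. I \<in> Q \<and> x \<in> I"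
  proof -
    obtain I where I: "I \<in> Q" "x \<in> I"
      using partition_onD1[OF assms] by blast
    moreover have "J = I" if "J \<in> Q" "x \<in> J" for J
      using disjointD[OF partition_onD2[OF assms] that(1) I(1)] that(2) I(2) by blast
    ultimately show ?thesis by blast
  qed
  show in_Q: "cell Q x \<in> Q" and "x \<in> cell Q x"
    using theI'[OF ex1] unfolding cell_def by simp_all
  show "cell Q x = I \<longleftrightarrow> x \<in> I" if "I \<in> Q"
  proof
    assume "x \<in> I"
    with that show "cell Q x = I" unfolding cell_def by (intro the1_equality[OF ex1]) simp
  qed (use \<open>x \<in> cell Q x\<close> in simp)
qed

lemma measurable_cell:
  assumes Q: "partition_on UNIV Q" "countable Q" "\<And>I. I \<in> Q \<Longrightarrow> is_interval I"
  shows "cell Q \<in> borel \<rightarrow>\<^sub>M count_space Q"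
proof -
  have "cell Q -` {I} \<inter> UNIV \<in> sets borel" if "I \<in> Q" for I
  proof -
    have "cell Q -` {I} = I" using cell_eq_iff[OF Q(1) that] by auto
    then show ?thesis using real_interval_borel_measurable[OF Q(3)[OF that]] by simp
  qed
  then show ?thesis
    using cell_in_partition[OF Q(1)] by (subst measurable_count_space_eq_countable[OF Q(2)]) auto
qed

lemma measurable_map_count_space:
  assumes L: "countable L" and f: "\<And>i. i \<in> set js \<Longrightarrow> (\<lambda>x. f x i) \<in> M \<rightarrow>\<^sub>M count_space L"
  shows "(\<lambda>x. map (f x) js) \<in> M \<rightarrow>\<^sub>M count_space (lists L)"
proof -
  have "(\<lambda>x. map (f x) js) -` {w} \<inter> space M \<in> sets M" if w: "w \<in> lists L" for w
  proof (cases "length w = length js")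
    case True
    have "(\<lambda>x. map (f x) js) -` {w} \<inter> space M
        = space M \<inter> (\<Inter>j\<in>{..<length js}. {x \<in> space M. f x (js ! j) = w ! j})"
      using True by (auto simp: list_eq_iff_nth_eq)
    also have "\<dots> \<in> sets M"
    proof (cases "js = []")
      case False
      have "((\<lambda>x. f x (js ! j)) -` {w ! j}) \<inter> space M \<in> sets M" if "j < length js" for j
        using that w True by (intro measurable_sets[OF f]) auto
      then have "{x \<in> space M. f x (js ! j) = w ! j} \<in> sets M" if "j < length js" for j
        using that by (simp add: vimage_def Int_def conj_commute)
      then show ?thesis using False by (intro sets.Int sets.finite_INT) auto
    qed simp
    finally show ?thesis .
  next
    case False
    then have "(\<lambda>x. map (f x) js) -` {w} \<inter> space M = {}" by auto
    then show ?thesis by simp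
  qed
  moreover have "map (f x) js \<in> lists L" if "x \<in> space M" for x
    using measurable_space[OF f that] by auto
  ultimately show ?thesis
    by (subst measurable_count_space_eq_countable[OF countable_lists[OF L]]) auto
qed

lemma partition_of_nested:
  assumes "nested_interval_partitions P"
  shows "partition_on UNIV (P k)" "countable (P k)" "\<And>I. I \<in> P k \<Longrightarrow> is_interval I"
    "refines UNIV (P (Suc k)) (P k)"
  using assms by (auto simp: nested_interval_partitions_def)

lemma measurable_quantized_block:
  assumes P: "nested_interval_partitions P"
    and x: "\<And>i. m \<le> i \<Longrightarrow> i \<le> n \<Longrightarrow> (\<lambda>\<omega>. x \<omega> i) \<in> borel_measurable F"
  shows "(\<lambda>\<omega>. quantized_block (P k) (x \<omega>) m n) \<in> F \<rightarrow>\<^sub>M count_space (lists (P k))"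
  unfolding quantized_block_def
  by (rule measurable_map_count_space[OF partition_of_nested(2)[OF P]])
    (rule measurable_compose[OF x measurable_cell[OF partition_of_nested(1-3)[OF P]]], auto)

lemma cell_eq_coarser:
  assumes P: "nested_interval_partitions P" and "m \<le> n" and eq: "cell (P n) x = cell (P n) y"
  shows "cell (P m) x = cell (P m) y"
  using \<open>m \<le> n\<close> eq
proof (induction n rule: dec_induct)
  case (step n)
  note part = partition_of_nested(1)[OF P]
  obtain J where J: "J \<in> P n" "cell (P (Suc n)) x \<subseteq> J"
    using partition_of_nested(4)[OF P, of n] cell_in_partition[OF part] unfolding refines_def by metis
  have "x \<in> J" "y \<in> J"
    using J(2) mem_cell[OF part, of x "Suc n"] mem_cell[OF part, of y "Suc n"] step.prems by auto
  then have "cell (P n) x = cell (P n) y"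
    using cell_eq_iff[OF part J(1)] by metis
  then show ?case by (rule step.IH)
qed

lemma cell_decreasing:
  assumes P: "nested_interval_partitions P" and "m \<le> n"
  shows "cell (P n) x \<subseteq> cell (P m) x"
proof
  fix y assume "y \<in> cell (P n) x"
  then have "cell (P n) y = cell (P n) x"
    using cell_eq_iff[OF partition_of_nested(1)[OF P] cell_in_partition[OF partition_of_nested(1)[OF P]]] by blast
  then have "cell (P m) y = cell (P m) x" by (rule cell_eq_coarser[OF assms])
  then show "y \<in> cell (P m) x" using mem_cell[OF partition_of_nested(1)[OF P], of y m] by simp
qed

lemma abs_diff_le_ediam: "y \<in> C \<Longrightarrow> z \<in> C \<Longrightarrow> ereal \<bar>z - y\<bar> \<le> ediam C"
  unfolding ediam_def by (rule SUP_upper2[of "(y, z)"]) auto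

lemma ediam_mono: "C \<subseteq> D \<Longrightarrow> ediam C \<le> ediam D"
  unfolding ediam_def by (rule SUP_subset_mono) auto

text \<open>The values from \<open>k\<close> on lie in one cell of \<open>P (Suc k)\<close>, since agreement in a finer partition entails
  agreement in a coarser one. The cells may be half-open or unbounded, so nestedness
  alone would not give a limit; the small diameters make the sequence Cauchy.\<close>

lemma convergent_if_cells_agree:
  assumes P: "nested_interval_partitions P"
    and agree: "\<And>k. k0 \<le> k \<Longrightarrow> cell (P (Suc k)) (u (Suc k)) = cell (P (Suc k)) (u k)"
    and small: "\<And>e::real. 0 < e \<Longrightarrow> \<exists>k\<ge>k0. ediam (cell (P (Suc k)) (u k)) < ereal e"
  shows "convergent u"
proof (rule Cauchy_convergent, rule metric_CauchyI)
  fix e :: real assume "0 < e"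
  then obtain k where k: "k0 \<le> k" "ediam (cell (P (Suc k)) (u k)) < e" using small[of e] by auto
  have same: "cell (P (Suc k)) (u j) = cell (P (Suc k)) (u k)" if "k \<le> j" for j
    using that
  proof (induction j rule: dec_induct)
    case (step j)
    have "cell (P (Suc j)) (u (Suc j)) = cell (P (Suc j)) (u j)" using agree[of j] k(1) step.hyps by simp
    from cell_eq_coarser[OF P _ this, of "Suc k"] step show ?case by simp
  qed simp
  have "u j \<in> cell (P (Suc k)) (u k)" if "k \<le> j" for j
    using mem_cell[OF partition_of_nested(1)[OF P], of "u j" "Suc k"] same[OF that] by simp
  then have "ereal \<bar>u i - u j\<bar> < e" if "k \<le> i" "k \<le> j" for i j
    using abs_diff_le_ediam[of "u j" _ "u i"] k(2) that by (meson le_less_trans)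
  then show "\<exists>N. \<forall>i\<ge>N. \<forall>j\<ge>N. dist (u i) (u j) < e" by (auto simp: dist_real_def)
qed

section \<open>The recurrence times as stopping times\<close>

lemma observations_enat: "observations M X (enat n) = sigma_gen_by M X {0..int n}"
  unfolding observations_def by (rule arg_cong[where f = "sigma_gen_by M X"]) auto

lemma observations_infinity: "observations M X \<infinity> = sigma_gen_by M X {0..}"
  unfolding observations_def by (rule arg_cong[where f = "sigma_gen_by M X"]) auto

lemma space_sigma_gen_by [simp]: "space (sigma_gen_by M X I) = space M"
  by (simp add: sigma_gen_by_def)

lemma measurable_sigma_gen_by:
  assumes "i \<in> I"
  shows "X i \<in> borel_measurable (sigma_gen_by M X I)"
proof -
  have "(\<lambda>\<omega>. \<lambda>i\<in>I. X i \<omega>) \<in> sigma_gen_by M X I \<rightarrow>\<^sub>M (\<Pi>\<^sub>M i\<in>I. borel)"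
    unfolding sigma_gen_by_def by (rule measurable_vimage_algebra1) (auto simp: space_PiM)
  from measurable_compose[OF this measurable_component_singleton[OF assms]] assms show ?thesis by simp
qed

lemma sets_sigma_gen_by_subset:
  assumes "\<And>i. i \<in> I \<Longrightarrow> X i \<in> borel_measurable F" "space F = space M"
  shows "sets (sigma_gen_by M X I) \<subseteq> sets F"
  unfolding sigma_gen_by_def assms(2)[symmetric]
  by (rule sets_image_in_sets) (auto intro!: measurable_restrict assms(1))

lemma sets_sigma_gen_byE:
  assumes "A \<in> sets (sigma_gen_by M X I)"
  obtains B where "B \<in> sets (\<Pi>\<^sub>M i\<in>I. borel)" "A = {\<omega> \<in> space M. (\<lambda>i\<in>I. X i \<omega>) \<in> B}"
proof -
  have "(\<lambda>\<omega>. \<lambda>i\<in>I. X i \<omega>) \<in> space M \<rightarrow> space (\<Pi>\<^sub>M i\<in>I. borel)"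
    by (auto simp: space_PiM)
  from assms[unfolded sigma_gen_by_def sets_vimage_algebra2[OF this]]
  show ?thesis using that by (auto simp: vimage_def Int_def conj_commute)
qed

text \<open>The recurrence time from \<open>z\<close> is the return time of the block label for the path shifted by \<open>z\<close>.\<close>

lemma recurrence_eq_first_time:
  "recurrence P l x k z = first_time (\<lambda>t.
      quantized_block (P k) (time_shift (int t) (time_shift (int z) x)) (- (int (l k) - 1)) 0 =
      quantized_block (P k) (time_shift (int z) x) (- (int (l k) - 1)) 0)"
  unfolding recurrence_def first_time_def quantized_block_shift time_shift_add by (simp add: algebra_simps)

lemma zeta_Suc_eq_enat_iff:
  "zeta P l x (Suc k) = enat n \<longleftrightarrow>
     (\<exists>z<n. zeta P l x k = enat z \<and> recurrence P l x (Suc k) z = enat (n - z))"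
proof (cases "zeta P l x k")
  case (enat z)
  have "z < n" if "enat z + recurrence P l x (Suc k) z = enat n"
    using that first_time_positive unfolding recurrence_eq_first_time
    by (metis add.right_neutral enat_ord_simps(2) enat_add_left_cancel_less enat.distinct(1) zero_enat_def)
  then show ?thesis using enat by (cases "recurrence P l x (Suc k) z") auto
qed simp

text \<open>Since $l_{k+1} \le k + 1$, this bound keeps the block that ends at $\zeta_k$ within nonnegative
  times.\<close>

lemma zeta_ge: "zeta P l x k = enat n \<Longrightarrow> k \<le> n"
proof (induction k arbitrary: n)
  case (Suc k)
  then show ?case by (force simp: zeta_Suc_eq_enat_iff simp del: zeta.simps)
qed simp

lemma le_enat_iff: "x \<le> enat n \<longleftrightarrow> (\<exists>z\<le>n. x = enat z)"
  by (cases x) auto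

lemma zeta_less_Suc: "zeta P l x k < zeta P l x (Suc k)" if "zeta P l x k \<noteq> \<infinity>"
proof (cases "zeta P l x (Suc k)")
  case (enat n)
  moreover from this obtain z where "z < n" "zeta P l x k = enat z"
    by (auto simp: zeta_Suc_eq_enat_iff simp del: zeta.simps)
  ultimately show ?thesis by simp
qed (use that in auto)

lemma mono_zeta: "j \<le> k \<Longrightarrow> zeta P l x j \<le> zeta P l x k"
proof (rule lift_Suc_mono_le[of "zeta P l x"])
  show "zeta P l x n \<le> zeta P l x (Suc n)" for n
    using zeta_less_Suc[of P l x n] by (cases "zeta P l x n = \<infinity>") auto
qed

locale quantized_recurrence = prob_space M for M :: "'a measure" +
  fixes X :: "int \<Rightarrow> 'a \<Rightarrow> real" and P :: "nat \<Rightarrow> real set set" and l :: "nat \<Rightarrow> nat"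
  assumes X [measurable]: "\<And>n. X n \<in> borel_measurable M"
    and stationary: "stationary M X"
    and P: "nested_interval_partitions P"
    and l: "\<And>k. 1 \<le> k \<Longrightarrow> 1 \<le> l k \<and> l k \<le> k"
begin

abbreviation "traj \<omega> \<equiv> (\<lambda>n. X n \<omega>)"
abbreviation "Z k \<omega> \<equiv> zeta P l (traj \<omega>) k"
abbreviation "block k x \<equiv> quantized_block (P k) x (- (int (l k) - 1)) 0"
abbreviation "Obs \<equiv> observations M X"
abbreviation "F k \<equiv> stopped_sigma M X (Z k)"

definition law :: "(int \<Rightarrow> real) measure" where
  "law = distr M path_space traj"

text \<open>On the null event where $\zeta_k$ is infinite the shift is by \<^term>\<open>the_enat \<infinity>\<close>, the same fixed time
  that \<^const>\<open>next_obs\<close> uses.\<close>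

definition seen :: "nat \<Rightarrow> 'a \<Rightarrow> int \<Rightarrow> real" where
  "seen k \<omega> = time_shift (int (the_enat (Z k \<omega>))) (traj \<omega>)"

lemma space_Obs [simp]: "space (Obs t) = space M"
  by (simp add: observations_def)

lemma sets_Obs_subset: "sets (Obs t) \<subseteq> sets M"
  unfolding observations_def by (rule sets_sigma_gen_by_subset) auto

lemma measurable_Obs: "0 \<le> i \<Longrightarrow> i \<le> int n \<Longrightarrow> X i \<in> borel_measurable (Obs (enat n))"
  unfolding observations_enat by (rule measurable_sigma_gen_by) auto

text \<open>The comparison uses only the blocks ending at times between \<open>z\<close> and \<open>n\<close>. The assumption
  \<open>k \<le> z\<close> ensures that they start at nonnegative times, so that they are observed.\<close>

lemma pred_recurrence:
  assumes "k < n" "k \<le> z" "z \<le> n"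
  shows "Measurable.pred (Obs (enat n)) (\<lambda>\<omega>. recurrence P l (traj \<omega>) (Suc k) z = enat (n - z))"
proof -
  have lk: "int (l (Suc k)) - 1 \<le> int k" using l[of "Suc k"] by simp
  have meas: "(\<lambda>\<omega>. block (Suc k) (time_shift (int s) (time_shift (int z) (traj \<omega>))))
      \<in> Obs (enat n) \<rightarrow>\<^sub>M count_space (lists (P (Suc k)))" if "s \<le> n - z" for s
    unfolding quantized_block_shift time_shift_add
    using that assms lk by (intro measurable_quantized_block[OF P] measurable_Obs) auto
  have "Measurable.pred (Obs (enat n)) (\<lambda>\<omega>. block (Suc k) (time_shift (int s) (time_shift (int z) (traj \<omega>)))
      = block (Suc k) (time_shift (int z) (traj \<omega>)))" if "s \<le> n - z" for s
    using pred_eq_count_space[OF countable_lists[OF partition_of_nested(2)[OF P]] meas[OF that] meas[of 0]]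
    by simp
  note pred_block = this
  define E where "E s = {\<omega> \<in> space M. block (Suc k) (time_shift (int s) (time_shift (int z) (traj \<omega>)))
      = block (Suc k) (time_shift (int z) (traj \<omega>))}" for s
  have E: "E s \<in> sets (Obs (enat n))" if "s \<le> n - z" for s
    unfolding E_def using pred_block[OF that] by (simp add: pred_def)
  show ?thesis
  proof (cases "z < n")
    case True
    have "{\<omega> \<in> space (Obs (enat n)). recurrence P l (traj \<omega>) (Suc k) z = enat (n - z)}
        = E (n - z) - (\<Union>s\<in>{0<..<n - z}. E s)"
      unfolding recurrence_eq_first_time first_time_eq_enat_iff E_def using True by auto
    also have "\<dots> \<in> sets (Obs (enat n))"
      by (intro sets.Diff sets.finite_UN E) auto
    finally show ?thesis by (simp add: pred_def)
  next
    case False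
    then show ?thesis unfolding recurrence_eq_first_time first_time_eq_enat_iff by simp
  qed
qed

lemma pred_zeta_eq: "Measurable.pred (Obs (enat n)) (\<lambda>\<omega>. Z k \<omega> = enat n)"
proof (induction k arbitrary: n)
  case (Suc k)
  interpret filtration "space M" Obs by (rule filtration_observations)
  have "{\<omega> \<in> space M. Z (Suc k) \<omega> = enat n}
      = (\<Union>z\<in>{k..<n}. {\<omega> \<in> space M. Z k \<omega> = enat z} \<inter>
          {\<omega> \<in> space M. recurrence P l (traj \<omega>) (Suc k) z = enat (n - z)})"
    using zeta_ge[of P l _ k] by (auto simp: zeta_Suc_eq_enat_iff simp del: zeta.simps)
  also have "\<dots> \<in> sets (Obs (enat n))"
  proof (intro sets.finite_UN sets.Int)
    fix z assume z: "z \<in> {k..<n}"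
    have "{\<omega> \<in> space M. Z k \<omega> = enat z} \<in> sets (Obs (enat z))"
      using Suc.IH[of z] by (simp add: pred_def)
    then show "{\<omega> \<in> space M. Z k \<omega> = enat z} \<in> sets (Obs (enat n))"
      using sets_F_mono[of "enat z" "enat n"] z by auto
    show "{\<omega> \<in> space M. recurrence P l (traj \<omega>) (Suc k) z = enat (n - z)} \<in> sets (Obs (enat n))"
      using pred_recurrence[of k n z] z by (simp add: pred_def)
  qed simp
  finally show ?case by (simp add: pred_def del: zeta.simps)
qed (simp add: zero_enat_def)

lemma stopping_time_zeta: "stopping_time Obs (Z k)"
proof
  interpret filtration "space M" Obs by (rule filtration_observations)
  fix t
  have "{\<omega> \<in> space M. Z k \<omega> \<le> t} \<in> sets (Obs t)"
  proof (cases t)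
    case (enat n)
    have "{\<omega> \<in> space M. Z k \<omega> \<le> t} = (\<Union>z\<in>{..n}. {\<omega> \<in> space M. Z k \<omega> = enat z})"
      unfolding enat by (auto simp: le_enat_iff)
    also have "\<dots> \<in> sets (Obs t)"
    proof (intro sets.finite_UN)
      fix z assume "z \<in> {..n}"
      then show "{\<omega> \<in> space M. Z k \<omega> = enat z} \<in> sets (Obs t)"
        using pred_zeta_eq[of k z] sets_F_mono[of "enat z" t] by (auto simp: pred_def enat)
    qed simp
    finally show ?thesis .
  next
    case infinity
    then have "{\<omega> \<in> space M. Z k \<omega> \<le> t} = space (Obs t)" by auto
    then show ?thesis by (simp only: sets.top)
  qed
  then show "Measurable.pred (Obs t) (\<lambda>\<omega>. Z k \<omega> \<le> t)" by (simp add: pred_def)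
qed

lemma sets_zeta_eq [measurable]: "{\<omega> \<in> space M. Z k \<omega> = enat n} \<in> sets M"
  using pred_zeta_eq[of k n] sets_Obs_subset[of "enat n"] by (auto simp: pred_def)

lemma sets_F: "sets (F k) = {A. \<forall>t. {\<omega> \<in> A. Z k \<omega> \<le> t} \<in> sets (Obs t)}"
  unfolding stopped_sigma_def
  by (rule filtration.sets_pre_sigma[OF filtration_observations stopping_time_zeta])

lemma space_F [simp]: "space (F k) = space M"
  unfolding stopped_sigma_def by (rule filtration.space_pre_sigma[OF filtration_observations])

lemma sets_F_subset: "sets (F k) \<subseteq> sets M"
proof
  fix A assume "A \<in> sets (F k)"
  then have "{\<omega> \<in> A. Z k \<omega> \<le> \<infinity>} \<in> sets (Obs \<infinity>)" by (simp only: sets_F mem_Collect_eq)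
  then show "A \<in> sets M" using sets_Obs_subset by auto
qed

lemma subalgebra_F: "subalgebra M (F k)"
  unfolding subalgebra_def using sets_F_subset by auto

lemma sets_F_mono: "j \<le> k \<Longrightarrow> sets (F j) \<subseteq> sets (F k)"
  unfolding stopped_sigma_def
  by (intro filtration.mono_pre_sigma[OF filtration_observations] stopping_time_zeta mono_zeta)

lemma sets_F_Int_zeta_eq:
  assumes "A \<in> sets (F k)"
  shows "{\<omega> \<in> A. Z k \<omega> = enat n} \<in> sets (Obs (enat n))"
proof -
  have "A \<subseteq> space M" using sets.sets_into_space[OF assms] by simp
  then have "{\<omega> \<in> A. Z k \<omega> = enat n} = {\<omega> \<in> A. Z k \<omega> \<le> enat n} \<inter> {\<omega> \<in> space M. Z k \<omega> = enat n}"
    by auto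
  also have "\<dots> \<in> sets (Obs (enat n))"
    using assms pred_zeta_eq[of k n] by (intro sets.Int) (auto simp: sets_F pred_def)
  finally show ?thesis .
qed

text \<open>Discrete time: it suffices to test the individual values of the stopping time. The value \<open>\<infinity>\<close> is
  covered by the first assumption.\<close>

lemma sets_F_I:
  assumes "A \<in> sets (Obs \<infinity>)"
    and "\<And>n. {\<omega> \<in> A. Z k \<omega> = enat n} \<in> sets (Obs (enat n))"
  shows "A \<in> sets (F k)"
proof -
  interpret filtration "space M" Obs by (rule filtration_observations)
  have "{\<omega> \<in> A. Z k \<omega> \<le> t} \<in> sets (Obs t)" for t
  proof (cases t)
    case (enat n)
    have "{\<omega> \<in> A. Z k \<omega> \<le> t} = (\<Union>z\<in>{..n}. {\<omega> \<in> A. Z k \<omega> = enat z})"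
      unfolding enat by (auto simp: le_enat_iff)
    also have "\<dots> \<in> sets (Obs t)"
      using assms(2) sets_F_mono[of "enat _" t] by (intro sets.finite_UN) (auto simp: enat)
    finally show ?thesis .
  next
    case infinity
    then show ?thesis using assms(1) by simp
  qed
  then show ?thesis by (simp add: sets_F)
qed

end

section \<open>The process seen from a recurrence time\<close>

context quantized_recurrence
begin

lemma measurable_traj [measurable]: "(\<lambda>\<omega>. traj \<omega>) \<in> M \<rightarrow>\<^sub>M path_space"
  by (rule measurable_path[where X = X, OF X])

lemma sets_law [measurable_cong]: "sets law = sets path_space"
  by (simp add: law_def)

lemma measurable_block: "block k \<in> path_space \<rightarrow>\<^sub>M count_space (lists (P k))"
  by (rule measurable_quantized_block[OF P]) simp

lemma measurable_zeta_sub: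
  assumes "space F' = space M" "\<And>n. {\<omega> \<in> space M. Z k \<omega> = enat n} \<in> sets F'"
  shows "Z k \<in> F' \<rightarrow>\<^sub>M count_space UNIV"
proof -
  have "{\<omega> \<in> space M. Z k \<omega> = c} \<in> sets F'" for c
  proof (cases c)
    case infinity
    have "{\<omega> \<in> space M. Z k \<omega> = c} = space F' - (\<Union>n. {\<omega> \<in> space M. Z k \<omega> = enat n})"
      unfolding infinity assms(1) by auto
    then show ?thesis using assms(2) by auto
  qed (use assms(2) in auto)
  then show ?thesis
    by (subst measurable_count_space_eq_countable) (auto simp: vimage_def Int_def conj_commute assms(1))
qed

lemma measurable_zeta [measurable]: "Z k \<in> M \<rightarrow>\<^sub>M count_space UNIV"
  by (rule measurable_zeta_sub) auto

lemma measurable_seen [measurable]: "seen k \<in> M \<rightarrow>\<^sub>M path_space"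
  unfolding seen_def[abs_def]
  by (rule measurable_compose_countable[where g = "Z k" and
        f = "\<lambda>t \<omega>. time_shift (int (the_enat t)) (traj \<omega>)"]) auto

lemma seen_zero: "seen 0 \<omega> = traj \<omega>"
  by (simp add: seen_def zero_enat_def)

text \<open>Given that $\zeta_k$ is finite, the path seen from $\zeta_{k+1}$ is the image of the path seen from
  $\zeta_k$ under the return map of the level $k+1$ block, which preserves the law.\<close>

lemma law_of_seen: "(AE \<omega> in M. Z k \<omega> \<noteq> \<infinity>) \<and> distr M path_space (seen k) = law"
proof (induction k)
  case 0
  then show ?case by (simp add: seen_zero[abs_def] law_def)
next
  case (Suc k)
  have fin: "AE \<omega> in M. Z k \<omega> \<noteq> \<infinity>" and Rk: "distr M path_space (seen k) = law"
    using Suc by auto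
  interpret flow: measure_preserving_flow law time_shift
    unfolding law_def by (rule flow_of_stationary) (use prob_space_axioms stationary in auto)
  have b: "block (Suc k) \<in> law \<rightarrow>\<^sub>M count_space (lists (P (Suc k)))"
    using measurable_block by (simp cong: measurable_cong_sets add: sets_law)
  note L = countable_lists[OF partition_of_nested(2)[OF P, of "Suc k"]]
  define r where "r = return_time time_shift (block (Suc k))"
  define S where "S x = time_shift (int (the_enat (r x))) x" for x
  have S [measurable]: "S \<in> path_space \<rightarrow>\<^sub>M path_space"
    using flow.measurable_return_map[OF L b]
    unfolding S_def[abs_def] r_def by (simp cong: measurable_cong_sets add: sets_law)
  have step: "Z (Suc k) \<omega> = Z k \<omega> + r (seen k \<omega>)" if "Z k \<omega> \<noteq> \<infinity>" for \<omega>
    using that by (auto simp: r_def return_time_def seen_def recurrence_eq_first_time)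
  have "AE x in law. r x \<noteq> \<infinity>"
    unfolding r_def by (rule flow.AE_recurrence[OF L b])
  then have ret_fin: "AE \<omega> in M. r (seen k \<omega>) \<noteq> \<infinity>"
    unfolding Rk[symmetric] by (rule AE_distrD[OF measurable_seen])
  have "AE \<omega> in M. Z (Suc k) \<omega> \<noteq> \<infinity>"
    using fin ret_fin by eventually_elim (auto simp: step simp del: zeta.simps)
  moreover have "distr M path_space (seen (Suc k)) = law"
  proof -
    have "AE \<omega> in M. seen (Suc k) \<omega> = S (seen k \<omega>)"
      using fin ret_fin
    proof eventually_elim
      case (elim \<omega>)
      then obtain z t where "Z k \<omega> = enat z" "r (seen k \<omega>) = enat t" by auto
      then show ?case
        using step[of \<omega>] by (simp add: S_def seen_def add.commute del: zeta.simps)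
    qed
    then have "distr M path_space (seen (Suc k)) = distr M path_space (\<lambda>\<omega>. S (seen k \<omega>))"
      by (intro distr_cong_AE) auto
    also have "\<dots> = distr (distr M path_space (seen k)) path_space S"
      by (subst distr_distr) (auto simp: comp_def)
    also have "\<dots> = distr law law S"
      unfolding Rk by (rule distr_cong) (auto simp: sets_law)
    also have "\<dots> = law"
      unfolding S_def[abs_def] r_def by (rule flow.return_map_preserves[OF L b])
    finally show ?thesis .
  qed
  ultimately show ?case by blast
qed

lemma AE_zeta_finite: "AE \<omega> in M. \<forall>k. Z k \<omega> \<noteq> \<infinity>"
  using law_of_seen by (simp add: AE_all_countable)

lemma distr_seen: "distr M path_space (seen k) = distr M path_space traj"
  using law_of_seen[of k] by (simp add: law_def)

lemma
  fixes g :: "(int \<Rightarrow> real) \<Rightarrow> real"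
  assumes g [measurable]: "g \<in> borel_measurable path_space"
  shows integral_seen: "(\<integral>\<omega>. g (seen k \<omega>) \<partial>M) = (\<integral>\<omega>. g (traj \<omega>) \<partial>M)"
    and integrable_seen: "integrable M (\<lambda>\<omega>. g (seen k \<omega>)) \<longleftrightarrow> integrable M (\<lambda>\<omega>. g (traj \<omega>))"
proof -
  show "(\<integral>\<omega>. g (seen k \<omega>) \<partial>M) = (\<integral>\<omega>. g (traj \<omega>) \<partial>M)"
    using integral_distr[OF measurable_seen g, of k] integral_distr[OF measurable_traj g] by (simp add: distr_seen)
  show "integrable M (\<lambda>\<omega>. g (seen k \<omega>)) \<longleftrightarrow> integrable M (\<lambda>\<omega>. g (traj \<omega>))"
    using integrable_distr_eq[OF measurable_seen g, of k] integrable_distr_eq[OF measurable_traj g] by (simp add: distr_seen)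
qed

lemma prob_seen:
  assumes "A \<in> sets path_space"
  shows "prob {\<omega> \<in> space M. seen k \<omega> \<in> A} = prob {\<omega> \<in> space M. traj \<omega> \<in> A}"
  using measure_distr[OF measurable_seen assms, of k] measure_distr[OF measurable_traj assms]
  by (simp add: distr_seen vimage_def Int_def conj_commute)

lemma
  fixes g :: "(int \<Rightarrow> real) \<Rightarrow> real"
  assumes g [measurable]: "g \<in> borel_measurable path_space"
  shows integral_shift: "(\<integral>\<omega>. g (time_shift h (traj \<omega>)) \<partial>M) = (\<integral>\<omega>. g (traj \<omega>) \<partial>M)"
    and integrable_shift: "integrable M (\<lambda>\<omega>. g (time_shift h (traj \<omega>))) \<longleftrightarrow> integrable M (\<lambda>\<omega>. g (traj \<omega>))"
proof -
  have eq: "distr M path_space (\<lambda>\<omega>. time_shift h (traj \<omega>)) = distr M path_space traj"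
    using stationary by (simp add: stationary_def time_shift_def)
  have m: "(\<lambda>\<omega>. time_shift h (traj \<omega>)) \<in> M \<rightarrow>\<^sub>M path_space" by measurable
  show "(\<integral>\<omega>. g (time_shift h (traj \<omega>)) \<partial>M) = (\<integral>\<omega>. g (traj \<omega>) \<partial>M)"
    using integral_distr[OF m g] integral_distr[OF measurable_traj g] by (simp add: eq)
  show "integrable M (\<lambda>\<omega>. g (time_shift h (traj \<omega>))) \<longleftrightarrow> integrable M (\<lambda>\<omega>. g (traj \<omega>))"
    using integrable_distr_eq[OF m g] integrable_distr_eq[OF measurable_traj g] by (simp add: eq)
qed

lemma next_obs_eq: "next_obs P l (traj \<omega>) k = seen k \<omega> 1"
  by (simp add: next_obs_def seen_def time_shift_def add.commute)

lemma sets_F_I_finite: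
  assumes "\<And>\<omega>. \<omega> \<in> A \<Longrightarrow> Z k \<omega> \<noteq> \<infinity>"
    and A: "\<And>n. {\<omega> \<in> A. Z k \<omega> = enat n} \<in> sets (Obs (enat n))"
  shows "A \<in> sets (F k)"
proof (rule sets_F_I[OF _ A])
  interpret filtration "space M" Obs by (rule filtration_observations)
  have "A = (\<Union>n. {\<omega> \<in> A. Z k \<omega> = enat n})" using assms(1) by auto
  also have "\<dots> \<in> sets (Obs \<infinity>)"
    using A sets_F_mono[of "enat _" \<infinity>] by (intro sets.countable_UN) auto
  finally show "A \<in> sets (Obs \<infinity>)" .
qed

text \<open>The next value $X_{\zeta_j+1}$ has been observed by time $\zeta_k$ because
  $\zeta_j + 1 \le \zeta_k$.\<close>

lemma measurable_next_obs_F: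
  assumes "j < k"
  shows "(\<lambda>\<omega>. seen j \<omega> 1) \<in> borel_measurable (F k)"
proof (rule measurableI)
  interpret filtration "space M" Obs by (rule filtration_observations)
  fix B :: "real set" assume B: "B \<in> sets borel"
  have R1: "seen j \<omega> 1 = X (int (the_enat (Z j \<omega>)) + 1) \<omega>" for \<omega>
    by (simp add: seen_def time_shift_def add.commute)
  have Zj: "{\<omega> \<in> space M. Z j \<omega> = enat n} \<in> sets (Obs \<infinity>)" for n
    using pred_zeta_eq[of j n] sets_F_mono[of "enat n" \<infinity>] by (auto simp: pred_def)
  have "(\<lambda>\<omega>. seen j \<omega> 1) \<in> borel_measurable (Obs \<infinity>)"
    unfolding R1
    by (rule measurable_compose_countable[where g = "Z j" and f = "\<lambda>t \<omega>. X (int (the_enat t) + 1) \<omega>"])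
      (auto intro!: measurable_zeta_sub Zj intro: measurable_sigma_gen_by[where I = "{0..}", folded observations_infinity])
  from measurable_sets[OF this B] have 1: "{\<omega> \<in> space M. seen j \<omega> 1 \<in> B} \<in> sets (Obs \<infinity>)"
    by (simp add: vimage_def Int_def conj_commute)
  have 2: "{\<omega> \<in> {\<omega> \<in> space M. seen j \<omega> 1 \<in> B}. Z k \<omega> = enat n} \<in> sets (Obs (enat n))" for n
  proof -
    have less: "\<exists>z<n. Z j \<omega> = enat z" if "Z k \<omega> = enat n" for \<omega>
    proof -
      have le: "Z j \<omega> \<le> Z k \<omega>" "Z (Suc j) \<omega> \<le> Z k \<omega>" using assms by (auto intro!: mono_zeta simp del: zeta.simps)
      have "Z j \<omega> \<noteq> \<infinity>" using le(1) that by (cases "Z j \<omega>") auto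
      from zeta_less_Suc[OF this] le(2) have "Z j \<omega> < enat n" using that by (metis order_less_le_trans)
      then show ?thesis by (cases "Z j \<omega>") auto
    qed
    have "{\<omega> \<in> {\<omega> \<in> space M. seen j \<omega> 1 \<in> B}. Z k \<omega> = enat n}
        = (\<Union>z\<in>{..<n}. ({\<omega> \<in> space M. Z j \<omega> = enat z} \<inter> {\<omega> \<in> space M. Z k \<omega> = enat n})
            \<inter> {\<omega> \<in> space M. X (int z + 1) \<omega> \<in> B})"
      unfolding R1 using less by fastforce
    also have "\<dots> \<in> sets (Obs (enat n))"
    proof (intro sets.finite_UN sets.Int)
      fix z assume z: "z \<in> {..<n}"
      show "{\<omega> \<in> space M. Z j \<omega> = enat z} \<in> sets (Obs (enat n))"
        using pred_zeta_eq[of j z] sets_F_mono[of "enat z" "enat n"] z by (auto simp: pred_def)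
      show "{\<omega> \<in> space M. Z k \<omega> = enat n} \<in> sets (Obs (enat n))"
        using pred_zeta_eq[of k n] by (simp add: pred_def)
      have "X (int z + 1) \<in> borel_measurable (Obs (enat n))"
        using z by (intro measurable_Obs) auto
      from measurable_sets[OF this B] show "{\<omega> \<in> space M. X (int z + 1) \<omega> \<in> B} \<in> sets (Obs (enat n))"
        by (simp add: vimage_def Int_def conj_commute)
    qed simp
    finally show ?thesis .
  qed
  show "(\<lambda>\<omega>. seen j \<omega> 1) -` B \<inter> space (F k) \<in> sets (F k)"
    using sets_F_I[OF 1 2] by (simp add: vimage_def Int_def conj_commute)
qed simp

text \<open>The last \<open>m\<close> coordinates of the past have been observed at time $\zeta_k$ once $\zeta_k \ge m$.\<close>

lemma cylinder_in_F:
  fixes I :: "nat \<Rightarrow> real set"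
  assumes I: "\<And>i. I i \<in> sets borel"
  shows "{\<omega> \<in> space M. (\<exists>n\<ge>m. Z k \<omega> = enat n) \<and> (\<forall>i<m. seen k \<omega> (- int i) \<in> I i)} \<in> sets (F k)"
proof (rule sets_F_I_finite)
  fix n
  have "{\<omega> \<in> {\<omega> \<in> space M. (\<exists>n\<ge>m. Z k \<omega> = enat n) \<and> (\<forall>i<m. seen k \<omega> (- int i) \<in> I i)}. Z k \<omega> = enat n}
      = (if n < m then {} else {\<omega> \<in> space M. Z k \<omega> = enat n} \<inter>
          {\<omega> \<in> space (Obs (enat n)). \<forall>i\<in>{..<m}. X (int n - int i) \<omega> \<in> I i})"
    by (auto simp: seen_def time_shift_def)
  also have "\<dots> \<in> sets (Obs (enat n))"
  proof (cases "n < m")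
    case False
    have "{\<omega> \<in> space (Obs (enat n)). \<forall>i\<in>{..<m}. X (int n - int i) \<omega> \<in> I i} \<in> sets (Obs (enat n))"
    proof (rule sets.sets_Collect_finite_All)
      fix i assume "i \<in> {..<m}"
      then have "X (int n - int i) \<in> borel_measurable (Obs (enat n))"
        using False by (intro measurable_Obs) auto
      from measurable_sets[OF this I] show "{\<omega> \<in> space (Obs (enat n)). X (int n - int i) \<omega> \<in> I i} \<in> sets (Obs (enat n))"
        by (simp add: vimage_def Int_def conj_commute)
    qed auto
    then show ?thesis using False pred_zeta_eq[of k n] by (auto simp: pred_def)
  qed simp
  finally show "{\<omega> \<in> {\<omega> \<in> space M. (\<exists>n\<ge>m. Z k \<omega> = enat n) \<and> (\<forall>i<m. seen k \<omega> (- int i) \<in> I i)}. Z k \<omega> = enat n}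
      \<in> sets (Obs (enat n))" .
qed auto

end

section \<open>Almost sure limits of identically distributed sequences\<close>

text \<open>All \<open>A k\<close> with \<open>k \<ge> k0\<close> occur together with at most the least of their probabilities.\<close>

lemma (in prob_space) AE_exists_notin:
  fixes A :: "nat \<Rightarrow> 'a set"
  assumes A: "\<And>k. A k \<in> events" and lim: "(\<lambda>k. prob (A k)) \<longlonglongrightarrow> 0"
  shows "AE x in M. \<exists>k\<ge>k0. x \<notin> A k"
proof (rule AE_I)
  let ?N = "\<Inter>k\<in>{k0..}. A k"
  show "?N \<in> events" using A by (intro sets.countable_INT') auto
  have "prob ?N \<le> prob (A k)" if "k0 \<le> k" for k
    using that A \<open>?N \<in> events\<close> by (intro finite_measure_mono) auto
  then have "prob ?N \<le> 0"
    by (intro LIMSEQ_le_const[OF lim]) auto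
  then show "emeasure M ?N = 0" by (simp add: emeasure_eq_measure measure_le_0_iff)
qed auto

text \<open>The reverse Fatou lemma for events.\<close>

lemma (in prob_space) prob_infinitely_often_ge:
  fixes A :: "nat \<Rightarrow> 'a set"
  assumes A: "\<And>k. A k \<in> events" and c: "\<And>k. c \<le> prob (A k)"
  shows "{x \<in> space M. \<exists>\<^sub>\<infinity>k. x \<in> A k} \<in> events" "c \<le> prob {x \<in> space M. \<exists>\<^sub>\<infinity>k. x \<in> A k}"
proof -
  define U where "U n = (\<Union>k\<in>{n..}. A k)" for n :: nat
  have U: "U n \<in> events" for n unfolding U_def using A by auto
  have eq: "{x \<in> space M. \<exists>\<^sub>\<infinity>k. x \<in> A k} = (\<Inter>n. U n)"
    using sets.sets_into_space[OF A] by (fastforce simp: U_def INFM_nat_le)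
  show "{x \<in> space M. \<exists>\<^sub>\<infinity>k. x \<in> A k} \<in> events" unfolding eq using U by auto
  have "decseq U"
    unfolding decseq_def U_def by (intro allI impI UN_mono) auto
  then have "(\<lambda>n. prob (U n)) \<longlonglongrightarrow> prob (\<Inter>n. U n)"
    using U by (intro finite_Lim_measure_decseq) auto
  moreover have "c \<le> prob (U n)" for n
  proof -
    have "prob (A n) \<le> prob (U n)"
      using U by (intro finite_measure_mono) (auto simp: U_def)
    with c[of n] show ?thesis by linarith
  qed
  ultimately show "c \<le> prob {x \<in> space M. \<exists>\<^sub>\<infinity>k. x \<in> A k}"
    unfolding eq by (intro LIMSEQ_le_const) auto
qed

lemma tendsto_fun_iff:
  fixes u :: "nat \<Rightarrow> 'b \<Rightarrow> 'c::topological_space"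
  shows "u \<longlonglongrightarrow> v \<longleftrightarrow> (\<forall>i. (\<lambda>k. u k i) \<longlonglongrightarrow> v i)"
  using limitin_componentwise[of "\<lambda>_. euclidean" UNIV u v sequentially]
  by (simp add: euclidean_product_topology)

text \<open>By inner regularity \<open>C\<close> contains compact sets \<open>K\<close> of mass arbitrarily close to $1$. The sequence visits
  \<open>K\<close> infinitely often with probability at least the mass of \<open>K\<close>, and then its limit lies in \<open>K\<close>, which is
  closed.\<close>

lemma (in prob_space) AE_limit_in_support:
  fixes S :: "nat \<Rightarrow> 'a \<Rightarrow> nat \<Rightarrow> real"
  assumes S: "\<And>k. S k \<in> M \<rightarrow>\<^sub>M (\<Pi>\<^sub>M i\<in>UNIV. borel)"
    and law: "\<And>k. distr M (\<Pi>\<^sub>M i\<in>UNIV. borel) (S k) = \<mu>"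
    and C: "C \<in> sets (\<Pi>\<^sub>M i\<in>UNIV. borel)" "measure \<mu> C = 1"
    and conv: "AE \<omega> in M. \<forall>i. convergent (\<lambda>k. S k \<omega> i)"
  shows "AE \<omega> in M. \<exists>c\<in>C. \<forall>i. (\<lambda>k. S k \<omega> i) \<longlonglongrightarrow> c i"
proof -
  have sets_\<mu>: "sets \<mu> = sets borel"
    unfolding law[of 0, symmetric] by (simp add: sets_PiM_equal_borel)
  interpret \<mu>: prob_space \<mu>
    unfolding law[of 0, symmetric] by (rule prob_space_distr[OF S])
  have "emeasure \<mu> C = (SUP K\<in>{K. K \<subseteq> C \<and> compact K}. emeasure \<mu> K)"
    by (rule inner_regular[OF sets_\<mu>]) (use C in \<open>auto simp: sets_PiM_equal_borel\<close>)
  then have sup: "(SUP K\<in>{K. K \<subseteq> C \<and> compact K}. emeasure \<mu> K) = 1"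
    using C(2) by (simp add: \<mu>.emeasure_eq_measure)
  have "\<exists>K. K \<subseteq> C \<and> compact K \<and> 1 - 1 / Suc n < measure \<mu> K" for n
  proof -
    have "ennreal (1 - 1 / Suc n) < (SUP K\<in>{K. K \<subseteq> C \<and> compact K}. emeasure \<mu> K)"
      unfolding sup by (subst ennreal_1[symmetric], subst ennreal_less_iff) (auto simp: divide_simps)
    then obtain K where K: "K \<subseteq> C" "compact K" "ennreal (1 - 1 / Suc n) < emeasure \<mu> K"
      unfolding less_SUP_iff by blast
    then have "1 - 1 / Suc n < measure \<mu> K"
      unfolding \<mu>.emeasure_eq_measure by (subst (asm) ennreal_less_iff) (auto simp: divide_simps)
    with K show ?thesis by blast
  qed
  then obtain K where K: "\<And>n. K n \<subseteq> C" "\<And>n. compact (K n)" "\<And>n. 1 - 1 / Suc n < measure \<mu> (K n)"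
    by metis
  define B where "B n = {\<omega> \<in> space M. \<exists>\<^sub>\<infinity>k. \<omega> \<in> {\<omega> \<in> space M. S k \<omega> \<in> K n}}" for n
  have K_sets: "K n \<in> sets (\<Pi>\<^sub>M i\<in>UNIV. borel)" for n
    using compact_imp_closed[OF K(2)] by (simp add: sets_PiM_equal_borel)
  have A: "{\<omega> \<in> space M. S k \<omega> \<in> K n} \<in> events" for k n
    using measurable_sets[OF S K_sets] by (simp add: vimage_def Int_def conj_commute)
  have pA: "1 - 1 / Suc n \<le> prob {\<omega> \<in> space M. S k \<omega> \<in> K n}" for k n
    using K(3)[of n] measure_distr[OF S[of k] K_sets[of n]]
    by (simp add: law vimage_def Int_def conj_commute)
  have B: "B n \<in> events" "1 - 1 / Suc n \<le> prob (B n)" for n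
    unfolding B_def by (rule prob_infinitely_often_ge[OF A pA])+
  have "1 - 1 / Suc n \<le> prob (\<Union>n. B n)" for n
  proof -
    have "prob (B n) \<le> prob (\<Union>n. B n)" using B(1) by (intro finite_measure_mono) auto
    with B(2)[of n] show ?thesis by linarith
  qed
  moreover have "(\<lambda>n. 1 - 1 / real (Suc n)) \<longlonglongrightarrow> 1 - 0"
    by (intro tendsto_intros LIMSEQ_Suc[OF lim_1_over_n])
  ultimately have "1 - 0 \<le> prob (\<Union>n. B n)"
    by (intro LIMSEQ_le_const2) auto
  then have "prob (\<Union>n. B n) = 1" by (intro antisym prob_le_1) simp
  then have "AE \<omega> in M. \<omega> \<in> (\<Union>n. B n)" by (rule AE_prob_1)
  with conv show ?thesis
  proof eventually_elim
    case (elim \<omega>)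
    then obtain n where freq: "\<exists>\<^sub>\<infinity>k. S k \<omega> \<in> K n" by (auto simp: B_def)
    from elim(1) obtain c where c: "\<And>i. (\<lambda>k. S k \<omega> i) \<longlonglongrightarrow> c i"
      unfolding convergent_def by metis
    have lim: "(\<lambda>k. S k \<omega>) \<longlonglongrightarrow> c" unfolding tendsto_fun_iff using c by blast
    have "c \<in> K n"
    proof (rule ccontr)
      assume "c \<notin> K n"
      moreover have "open (- K n)" using compact_imp_closed[OF K(2)] by (simp add: open_Compl)
      ultimately have "eventually (\<lambda>k. S k \<omega> \<in> - K n) sequentially"
        by (intro topological_tendstoD[OF lim]) auto
      then have "\<not> (\<exists>\<^sub>\<infinity>k. S k \<omega> \<in> K n)"
        by (simp add: frequently_def cofinite_eq_sequentially)
      with freq show False by simp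
    qed
    with K(1) c show ?case by blast
  qed
qed

section \<open>Continuity in finitely many coordinates\<close>

text \<open>The coordinates from \<open>m\<close> on contribute at most $2^{-m}$ to the distance.\<close>

lemma past_dist_less_if_coordinates_close:
  assumes "0 < r"
  shows "\<exists>m \<delta>. 0 < \<delta> \<and> (\<forall>x y. (\<forall>i<m. \<bar>x i - y i\<bar> < \<delta>) \<longrightarrow> past_dist x y < r)"
proof -
  obtain m where m: "(1 / 2 :: real) ^ m < r / 2"
    using real_arch_pow_inv[of "r / 2" "1 / 2"] assms by auto
  have "past_dist x y < r" if close: "\<forall>i<m. \<bar>x i - y i\<bar> < r / 2" for x y
  proof -
    define a where "a i = (1 / 2) ^ (i + 1) * (\<bar>x i - y i\<bar> / (1 + \<bar>x i - y i\<bar>))" for i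
    have sm: "summable a" unfolding a_def by (rule summable_past_dist)
    have geo: "(\<lambda>i. (1 / 2 :: real) ^ (i + 1)) sums 1"
      using power_half_series by simp
    have tail_le: "a (i + m) \<le> (1 / 2) ^ m * (1 / 2) ^ (i + 1)" for i
    proof -
      have "a (i + m) \<le> (1 / 2) ^ (i + m + 1) * 1"
        unfolding a_def by (intro mult_left_mono) auto
      then show ?thesis by (simp add: power_add mult.commute mult.left_commute)
    qed
    have head_le: "a i \<le> (1 / 2) ^ (i + 1) * (r / 2)" if "i < m" for i
    proof -
      have "\<bar>x i - y i\<bar> / (1 + \<bar>x i - y i\<bar>) \<le> \<bar>x i - y i\<bar> / 1"
        by (intro divide_left_mono) auto
      also have "\<dots> \<le> r / 2" using close that by force
      finally show ?thesis unfolding a_def by (intro mult_left_mono) auto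
    qed
    have "past_dist x y = (\<Sum>i. a (i + m)) + (\<Sum>i<m. a i)"
      unfolding past_dist_def a_def[symmetric] by (rule suminf_split_initial_segment[OF sm])
    also have "(\<Sum>i. a (i + m)) \<le> (\<Sum>i. (1 / 2) ^ m * (1 / 2) ^ (i + 1))"
      using geo by (intro suminf_le tail_le summable_mult sums_summable[OF geo])
        (simp add: sm summable_iff_shift)
    also have "\<dots> = (1 / 2) ^ m"
      using sums_unique[OF sums_mult[OF geo, of "(1 / 2) ^ m"]] by simp
    also have "(\<Sum>i<m. a i) \<le> (\<Sum>i<m. (1 / 2) ^ (i + 1)) * (r / 2)"
      unfolding sum_distrib_right by (intro sum_mono head_le) simp
    also have "\<dots> \<le> 1 * (r / 2)"
      using assms sum_le_suminf[OF sums_summable[OF geo], of "{..<m}"] sums_unique[OF geo]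
      by (intro mult_right_mono) auto
    finally show ?thesis using m by simp
  qed
  with assms show ?thesis by (intro exI[of _ m] exI[of _ "r / 2"]) auto
qed

text \<open>Neighbourhoods given by finitely many coordinates are those that can be recognized from finitely many
  observations.\<close>

lemma continuous_on_past_finite_coordinates:
  assumes cont: "continuous_map (subtopology (Metric_space.mtopology UNIV past_dist) C) euclideanreal f"
    and "c \<in> C" "0 < \<epsilon>"
  shows "\<exists>m \<delta>. 0 < \<delta> \<and> (\<forall>y\<in>C. (\<forall>i<m. \<bar>c i - y i\<bar> < \<delta>) \<longrightarrow> \<bar>f y - f c\<bar> < \<epsilon>)"
proof -
  interpret D: Metric_space UNIV past_dist by (rule Metric_space_past_dist)
  define S where "S = {y \<in> topspace (subtopology D.mtopology C). f y \<in> ball (f c) \<epsilon>}"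
  have S_iff: "y \<in> S \<longleftrightarrow> y \<in> C \<and> \<bar>f y - f c\<bar> < \<epsilon>" for y
    by (simp add: S_def dist_real_def abs_minus_commute)
  have "openin (subtopology D.mtopology C) S"
    unfolding S_def by (rule openin_continuous_map_preimage[OF cont]) (simp flip: open_openin)
  then obtain T where T: "openin D.mtopology T" "S = T \<inter> C"
    unfolding openin_subtopology by metis
  have "c \<in> S" using S_iff \<open>c \<in> C\<close> \<open>0 < \<epsilon>\<close> by simp
  then have "c \<in> T" using T(2) by simp
  then obtain r where r: "0 < r" "D.mball c r \<subseteq> T"
    using T(1) unfolding D.openin_mtopology by metis
  obtain m \<delta> where "0 < \<delta>" and close: "\<And>x y. \<forall>i<m. \<bar>x i - y i\<bar> < \<delta> \<Longrightarrow> past_dist x y < r"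
    using past_dist_less_if_coordinates_close[OF r(1)] by blast
  have "\<bar>f y - f c\<bar> < \<epsilon>" if "y \<in> C" "\<forall>i<m. \<bar>c i - y i\<bar> < \<delta>" for y
  proof -
    have "y \<in> D.mball c r" using close[OF that(2)] by (simp add: D.in_mball)
    then have "y \<in> S" using r(2) T(2) that(1) by auto
    then show ?thesis using S_iff by simp
  qed
  with \<open>0 < \<delta>\<close> show ?thesis by blast
qed

section \<open>Predicting the value after a recurrence time\<close>

definition past_of :: "(int \<Rightarrow> real) \<Rightarrow> nat \<Rightarrow> real" where
  "past_of x = (\<lambda>i. x (- int i))"

lemma measurable_past_of [measurable]: "past_of \<in> path_space \<rightarrow>\<^sub>M (\<Pi>\<^sub>M i\<in>UNIV. borel)"
  unfolding past_of_def[abs_def] by (rule measurable_PiM_single') (auto simp: space_PiM)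

lemma past_eq_past_of: "past X \<omega> = past_of (\<lambda>n. X n \<omega>)"
  by (simp add: past_def past_of_def)

context quantized_recurrence
begin

lemma subalgebra_sigma_gen_by: "subalgebra M (sigma_gen_by M X J)"
  unfolding subalgebra_def using sets_sigma_gen_by_subset[of J X M M] by auto

text \<open>Shift the present to time $0$, replace \<open>X 1\<close> by its conditional expectation given the past, and
  shift back. Events determined by $X_0, \dots, X_n$ become events determined by the past.\<close>

lemma next_value_integral:
  assumes int1: "integrable M (X 1)" and f: "cond_exp_version M X f"
    and B: "B \<in> sets (Obs (enat n))"
  shows "(\<integral>\<omega>\<in>B. X (int n + 1) \<omega> \<partial>M) = (\<integral>\<omega>\<in>B. f (past_of (time_shift (int n) (traj \<omega>))) \<partial>M)"
proof -
  have [measurable]: "f \<in> borel_measurable (\<Pi>\<^sub>M i\<in>UNIV. borel)"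
    using f by (simp add: cond_exp_version_def)
  obtain B' where B' [measurable]: "B' \<in> sets (\<Pi>\<^sub>M i\<in>{0..int n}. borel)"
    and B_eq: "B = {\<omega> \<in> space M. (\<lambda>i\<in>{0..int n}. X i \<omega>) \<in> B'}"
    using B unfolding observations_enat by (elim sets_sigma_gen_byE)
  define h :: "(int \<Rightarrow> real) \<Rightarrow> real" where "h x = indicator B' (\<lambda>i\<in>{0..int n}. x i)" for x
  have h [measurable]: "h \<in> borel_measurable path_space"
  proof -
    have "(\<lambda>x. \<lambda>i\<in>{0..int n}. x i) \<in> path_space \<rightarrow>\<^sub>M (\<Pi>\<^sub>M i\<in>{0..int n}. borel :: real measure)"
      by (rule measurable_restrict) simp
    from measurable_compose[OF this borel_measurable_indicator[OF B']] show ?thesis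
      by (simp add: h_def[abs_def])
  qed
  define G where "G = sigma_gen_by M X {..0}"
  have sub: "subalgebra M G"
    unfolding G_def by (rule subalgebra_sigma_gen_by)
  interpret G: finite_measure_subalgebra M G
    by unfold_locales (rule sub)
  have hG: "(\<lambda>\<omega>. h (time_shift (- int n) (traj \<omega>))) \<in> borel_measurable G"
  proof -
    have "(\<lambda>\<omega>. \<lambda>i\<in>{0..int n}. X (i - int n) \<omega>) \<in> G \<rightarrow>\<^sub>M (\<Pi>\<^sub>M i\<in>{0..int n}. borel)"
      unfolding G_def by (intro measurable_restrict measurable_sigma_gen_by) auto
    from measurable_compose[OF this borel_measurable_indicator[OF B']] show ?thesis
      by (simp add: h_def[abs_def] time_shift_def)
  qed
  have hX: "integrable M (\<lambda>\<omega>. h (time_shift (- int n) (traj \<omega>)) * X 1 \<omega>)"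
    by (rule Bochner_Integration.integrable_bound[OF int1]) (auto simp: h_def indicator_def)
  have indB: "indicator B \<omega> = h (traj \<omega>)" if "\<omega> \<in> space M" for \<omega>
    using that by (simp add: B_eq h_def indicator_def)
  have "(\<integral>\<omega>\<in>B. X (int n + 1) \<omega> \<partial>M) = (\<integral>\<omega>. h (traj \<omega>) * traj \<omega> (int n + 1) \<partial>M)"
    unfolding set_lebesgue_integral_def using indB by (intro Bochner_Integration.integral_cong) auto
  also have "\<dots> = (\<integral>\<omega>. h (time_shift (- int n) (traj \<omega>)) * X 1 \<omega> \<partial>M)"
    using integral_shift[of "\<lambda>x. h x * x (int n + 1)" "- int n"] by (simp add: time_shift_def)
  also have "\<dots> = (\<integral>\<omega>. h (time_shift (- int n) (traj \<omega>)) * real_cond_exp M G (X 1) \<omega> \<partial>M)"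
    by (rule G.real_cond_exp_intg(2)[OF hX hG, symmetric]) simp
  also have "\<dots> = (\<integral>\<omega>. h (time_shift (- int n) (traj \<omega>)) * f (past_of (traj \<omega>)) \<partial>M)"
  proof (rule integral_cong_AE)
    show "AE \<omega> in M. h (time_shift (- int n) (traj \<omega>)) * real_cond_exp M G (X 1) \<omega>
        = h (time_shift (- int n) (traj \<omega>)) * f (past_of (traj \<omega>))"
      using f unfolding cond_exp_version_def past_eq_past_of G_def by (auto elim!: eventually_mono)
  qed measurable
  also have "\<dots> = (\<integral>\<omega>. h (traj \<omega>) * f (past_of (time_shift (int n) (traj \<omega>))) \<partial>M)"
    using integral_shift[of "\<lambda>x. h x * f (past_of (time_shift (int n) x))" "- int n"] by simp
  also have "\<dots> = (\<integral>\<omega>\<in>B. f (past_of (time_shift (int n) (traj \<omega>))) \<partial>M)"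
    unfolding set_lebesgue_integral_def using indB by (intro Bochner_Integration.integral_cong) auto
  finally show ?thesis .
qed

lemma integrable_version:
  assumes int1: "integrable M (X 1)" and f: "cond_exp_version M X f"
  shows "integrable M (\<lambda>\<omega>. f (past_of (traj \<omega>)))"
proof -
  define G where "G = sigma_gen_by M X {..0}"
  have sub: "subalgebra M G"
    unfolding G_def by (rule subalgebra_sigma_gen_by)
  interpret G: finite_measure_subalgebra M G
    by unfold_locales (rule sub)
  have [measurable]: "f \<in> borel_measurable (\<Pi>\<^sub>M i\<in>UNIV. borel)"
    using f by (simp add: cond_exp_version_def)
  have "integrable M (real_cond_exp M G (X 1))" by (rule G.real_cond_exp_int(1)[OF int1])
  moreover have "AE \<omega> in M. f (past_of (traj \<omega>)) = real_cond_exp M G (X 1) \<omega>"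
    using f unfolding cond_exp_version_def past_eq_past_of G_def by simp
  ultimately show ?thesis
    using integrable_cong_AE[of "\<lambda>\<omega>. f (past_of (traj \<omega>))" M "real_cond_exp M G (X 1)"] by simp
qed

text \<open>On $\{\zeta_k = n\}$ an event of the stopped $\sigma$-algebra is determined by $X_0, \dots, X_n$.\<close>

lemma next_value_integral_stopped:
  assumes int1: "integrable M (X 1)" and f: "cond_exp_version M X f"
    and A: "A \<in> sets (F k)"
  shows "(\<integral>\<omega>\<in>A. seen k \<omega> 1 \<partial>M) = (\<integral>\<omega>\<in>A. f (past_of (seen k \<omega>)) \<partial>M)"
proof -
  have [measurable]: "f \<in> borel_measurable (\<Pi>\<^sub>M i\<in>UNIV. borel)"
    using f by (simp add: cond_exp_version_def)
  \<comment> \<open>Up to the null event of an infinite stopping time, these pieces exhaust \<open>A\<close>.\<close>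
  define A' where "A' n = {\<omega> \<in> A. Z k \<omega> = enat n}" for n
  have A'_obs: "A' n \<in> sets (Obs (enat n))" for n
    unfolding A'_def by (rule sets_F_Int_zeta_eq[OF A])
  have A_sets: "A \<in> sets M" using A sets_F_subset by blast
  have A' [measurable]: "A' n \<in> sets M" for n using A'_obs sets_Obs_subset by blast
  have split: "(\<integral>\<omega>\<in>A. g \<omega> \<partial>M) = (\<Sum>n. \<integral>\<omega>\<in>A' n. g \<omega> \<partial>M)"
    if g: "integrable M g" for g :: "'a \<Rightarrow> real"
  proof -
    have [measurable]: "g \<in> borel_measurable M" "A \<in> sets M" using g A_sets by auto
    have "(\<integral>\<omega>\<in>A. g \<omega> \<partial>M) = (\<integral>\<omega>\<in>(\<Union>n. A' n). g \<omega> \<partial>M)"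
      unfolding set_lebesgue_integral_def
    proof (rule integral_cong_AE)
      show "AE \<omega> in M. indicator A \<omega> *\<^sub>R g \<omega> = indicator (\<Union>n. A' n) \<omega> *\<^sub>R g \<omega>"
        using AE_zeta_finite
      proof eventually_elim
        case (elim \<omega>)
        then obtain n where "Z k \<omega> = enat n" by auto
        then show ?case by (auto simp: A'_def indicator_def)
      qed
    qed measurable
    also have "\<dots> = (\<Sum>n. \<integral>\<omega>\<in>A' n. g \<omega> \<partial>M)"
    proof (rule lebesgue_integral_countable_add)
      show "set_integrable M (\<Union>n. A' n) g"
        unfolding set_integrable_def using g by (intro integrable_mult_indicator) auto
    qed (auto simp: A'_def)
    finally show ?thesis .
  qed
  have "integrable M (\<lambda>\<omega>. seen k \<omega> 1)"
    using integrable_seen[of "\<lambda>x. x 1" k] int1 by simp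
  moreover have "integrable M (\<lambda>\<omega>. f (past_of (seen k \<omega>)))"
    using integrable_seen[of "\<lambda>x. f (past_of x)" k] integrable_version[OF int1 f] by simp
  moreover have "(\<integral>\<omega>\<in>A' n. seen k \<omega> 1 \<partial>M) = (\<integral>\<omega>\<in>A' n. f (past_of (seen k \<omega>)) \<partial>M)" for n
  proof -
    have "(\<integral>\<omega>\<in>A' n. seen k \<omega> 1 \<partial>M) = (\<integral>\<omega>\<in>A' n. X (int n + 1) \<omega> \<partial>M)"
      by (rule set_lebesgue_integral_cong[OF A']) (auto simp: A'_def seen_def time_shift_def add.commute)
    also have "\<dots> = (\<integral>\<omega>\<in>A' n. f (past_of (time_shift (int n) (traj \<omega>))) \<partial>M)"
      by (rule next_value_integral[OF int1 f A'_obs])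
    also have "\<dots> = (\<integral>\<omega>\<in>A' n. f (past_of (seen k \<omega>)) \<partial>M)"
      by (rule set_lebesgue_integral_cong[OF A']) (auto simp: A'_def seen_def)
    finally show ?thesis .
  qed
  ultimately show ?thesis by (simp add: split)
qed

text \<open>This makes the pasts stabilize: by the choice of the recurrence time, the level $k+1$ block seen from
  $\zeta_{k+1}$ repeats the one seen from $\zeta_k$.\<close>

lemma block_seen_Suc:
  assumes "Z (Suc k) \<omega> \<noteq> \<infinity>"
  shows "block (Suc k) (seen (Suc k) \<omega>) = block (Suc k) (seen k \<omega>)"
proof -
  obtain n where n: "Z (Suc k) \<omega> = enat n" using assms by (cases "Z (Suc k) \<omega>") auto
  then obtain z where z: "z < n" "Z k \<omega> = enat z" "recurrence P l (traj \<omega>) (Suc k) z = enat (n - z)"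
    unfolding zeta_Suc_eq_enat_iff by blast
  then have "block (Suc k) (time_shift (int (n - z)) (time_shift (int z) (traj \<omega>)))
      = block (Suc k) (time_shift (int z) (traj \<omega>))"
    unfolding recurrence_eq_first_time first_time_eq_enat_iff by blast
  with n z show ?thesis by (simp add: seen_def of_nat_diff del: zeta.simps)
qed

end

context quantized_recurrence
begin

text \<open>By invariance the cell of $X_{\zeta_k-i}$ has small diameter with probability tending to $1$; hence
  almost surely it has small diameter for arbitrarily late \<open>k\<close>, which is all that the Cauchy argument
  requires.\<close>

lemma AE_coordinates_converge:
  assumes fine: "\<And>x. (\<lambda>k. ediam (cell (P k) x)) \<longlonglongrightarrow> 0"
    and l_lim: "filterlim l at_top sequentially"
  shows "AE \<omega> in M. \<forall>i. convergent (\<lambda>k. past_of (seen k \<omega>) i)"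
  unfolding AE_all_countable
proof
  fix i :: nat
  have "eventually (\<lambda>k. Suc i \<le> l k) sequentially"
    using l_lim by (rule filterlim_at_top[THEN iffD1, rule_format])
  then obtain k0 where k0: "\<And>k. k0 \<le> k \<Longrightarrow> i < l k"
    unfolding eventually_sequentially Suc_le_eq by blast
  \<comment> \<open>The bounds \<open>1 / Suc p\<close> suffice and keep the number of exceptional null sets countable.\<close>
  define Big where "Big p k = {x. ereal (1 / Suc p) \<le> ediam (cell (P (Suc k)) x)}" for p k :: nat
  have Big: "Big p k \<in> sets borel" for p k
  proof -
    have "(\<lambda>x. ediam (cell (P (Suc k)) x)) \<in> borel_measurable borel"
      by (rule measurable_compose[OF measurable_cell[OF partition_of_nested(1-3)[OF P]]]) auto
    then show ?thesis unfolding Big_def by measurable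
  qed
  have "AE \<omega> in M. \<exists>k\<ge>k0. \<omega> \<notin> {\<omega> \<in> space M. seen k \<omega> (- int i) \<in> Big p k}" for p
  proof (rule AE_exists_notin)
    note [measurable] = Big[of p]
    have Big_path: "{x. x (- int i) \<in> Big p k} \<in> sets path_space" for k
    proof -
      have "{x \<in> space path_space. x (- int i) \<in> Big p k} \<in> sets path_space" by measurable
      then show ?thesis by (simp add: space_PiM)
    qed
    show "{\<omega> \<in> space M. seen k \<omega> (- int i) \<in> Big p k} \<in> events" for k
      using measurable_sets[OF measurable_seen[of k] Big_path[of k]] by (simp add: vimage_def Int_def conj_commute)
    define E where "E k = {\<omega> \<in> space M. X (- int i) \<omega> \<in> Big p k}" for k
    have same: "prob {\<omega> \<in> space M. seen k \<omega> (- int i) \<in> Big p k} = prob (E k)" for k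
      using prob_seen[OF Big_path, of k k] by (simp add: E_def)
    have E_sets: "E k \<in> events" for k unfolding E_def by measurable
    have "decseq E"
      unfolding decseq_def
    proof (intro allI impI subsetI)
      fix m n \<omega> assume "m \<le> n" "\<omega> \<in> E n"
      moreover have "ediam (cell (P (Suc n)) x) \<le> ediam (cell (P (Suc m)) x)" for x
        using \<open>m \<le> n\<close> by (intro ediam_mono cell_decreasing[OF P]) simp
      ultimately show "\<omega> \<in> E m" unfolding E_def Big_def by (auto intro: order_trans)
    qed
    then have "(\<lambda>k. prob (E k)) \<longlonglongrightarrow> prob (\<Inter>k. E k)"
      using E_sets by (intro finite_Lim_measure_decseq) auto
    moreover have "(\<Inter>k. E k) = {}"
    proof (rule ccontr)
      assume "(\<Inter>k. E k) \<noteq> {}"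
      then obtain \<omega> where "\<And>k. \<omega> \<in> E k" by blast
      then have "ereal (1 / Suc p) \<le> ediam (cell (P (Suc k)) (X (- int i) \<omega>))" for k
        by (auto simp: E_def Big_def)
      then have "ereal (1 / Suc p) \<le> 0"
        by (intro LIMSEQ_le_const[OF LIMSEQ_Suc[OF fine[of "X (- int i) \<omega>"]]]) auto
      then show False by simp
    qed
    ultimately show "(\<lambda>k. prob {\<omega> \<in> space M. seen k \<omega> (- int i) \<in> Big p k}) \<longlonglongrightarrow> 0"
      by (simp add: same)
  qed
  then have "AE \<omega> in M. \<forall>p. \<exists>k\<ge>k0. \<omega> \<notin> {\<omega> \<in> space M. seen k \<omega> (- int i) \<in> Big p k}"
    by (simp add: AE_all_countable)
  with AE_zeta_finite AE_space show "AE \<omega> in M. convergent (\<lambda>k. past_of (seen k \<omega>) i)"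
  proof eventually_elim
    case (elim \<omega>)
    show ?case
    proof (rule convergent_if_cells_agree[OF P, of k0])
      fix k assume "k0 \<le> k"
      then have "int i \<le> 0 - (- (int (l (Suc k)) - 1))" using k0[of "Suc k"] by simp
      with block_seen_Suc[of \<omega> k] elim(1)
      have "cell (P (Suc k)) (seen (Suc k) \<omega> (0 - int i)) = cell (P (Suc k)) (seen k \<omega> (0 - int i))"
        unfolding quantized_block_eq_iff[OF refl] by blast
      then show "cell (P (Suc k)) (past_of (seen (Suc k) \<omega>) i) = cell (P (Suc k)) (past_of (seen k \<omega>) i)"
        by (simp add: past_of_def)
    next
      fix e :: real assume "0 < e"
      then obtain p where p: "1 / Suc p < e" using nat_approx_posE by blast
      obtain k where "k0 \<le> k" "\<not> ereal (1 / Suc p) \<le> ediam (cell (P (Suc k)) (seen k \<omega> (- int i)))"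
        using elim(2,3) by (auto simp: Big_def)
      moreover have "ereal (1 / Suc p) < ereal e" using p by simp
      ultimately show "\<exists>k\<ge>k0. ediam (cell (P (Suc k)) (past_of (seen k \<omega>) i)) < ereal e"
        unfolding past_of_def by (meson not_le order_less_trans)
    qed
  qed
qed

lemma AE_past_converges_in_support:
  assumes "\<And>x. (\<lambda>k. ediam (cell (P k) x)) \<longlonglongrightarrow> 0"
    and "filterlim l at_top sequentially"
    and C: "C \<in> sets (\<Pi>\<^sub>M i\<in>UNIV. borel)" "measure (distr M (\<Pi>\<^sub>M i\<in>UNIV. borel) (past X)) C = 1"
  shows "AE \<omega> in M. \<exists>c\<in>C. \<forall>i. (\<lambda>k. past_of (seen k \<omega>) i) \<longlonglongrightarrow> c i"
proof (rule AE_limit_in_support[OF _ _ C])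
  show "(\<lambda>\<omega>. past_of (seen k \<omega>)) \<in> M \<rightarrow>\<^sub>M (\<Pi>\<^sub>M i\<in>UNIV. borel)" for k by measurable
  have "distr M (\<Pi>\<^sub>M i\<in>UNIV. borel) (\<lambda>\<omega>. past_of (seen k \<omega>))
      = distr (distr M path_space (seen k)) (\<Pi>\<^sub>M i\<in>UNIV. borel) past_of" for k
    by (subst distr_distr) (auto simp: comp_def)
  also have "\<dots> k = distr M (\<Pi>\<^sub>M i\<in>UNIV. borel) (past X)" for k
    unfolding distr_seen by (subst distr_distr) (auto simp: comp_def past_eq_past_of[abs_def])
  finally show "distr M (\<Pi>\<^sub>M i\<in>UNIV. borel) (\<lambda>\<omega>. past_of (seen k \<omega>))
      = distr M (\<Pi>\<^sub>M i\<in>UNIV. borel) (past X)" for k .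
qed (rule AE_coordinates_converge[OF assms(1,2)])

lemma AE_past_in_support:
  assumes C: "C \<in> sets (\<Pi>\<^sub>M i\<in>UNIV. borel)" "measure (distr M (\<Pi>\<^sub>M i\<in>UNIV. borel) (past X)) C = 1"
  shows "AE \<omega> in M. past_of (seen k \<omega>) \<in> C"
proof -
  have C_path: "{x. past_of x \<in> C} \<in> sets path_space"
    using measurable_sets[OF measurable_past_of C(1)] by (simp add: vimage_def space_PiM)
  have "(\<lambda>\<omega>. past_of (traj \<omega>)) \<in> M \<rightarrow>\<^sub>M (\<Pi>\<^sub>M i\<in>UNIV. borel)" by measurable
  from measure_distr[OF this C(1)] C(2)
  have "prob {\<omega> \<in> space M. past_of (traj \<omega>) \<in> C} = 1"
    by (simp add: past_eq_past_of[abs_def] vimage_def Int_def conj_commute)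
  then have "prob {\<omega> \<in> space M. past_of (seen k \<omega>) \<in> C} = 1"
    using prob_seen[OF C_path, of k] by simp
  from AE_prob_1[OF this] show ?thesis by (auto elim!: eventually_mono)
qed

definition cond_next :: "nat \<Rightarrow> 'a \<Rightarrow> real" where
  "cond_next k = real_cond_exp M (F k) (\<lambda>\<omega>. seen k \<omega> 1)"

text \<open>The pasts compatible with the observed last \<open>m\<close> coordinates almost surely lie in \<open>C\<close>, and on all of
  them \<open>f\<close> obeys the bounds, so the average of \<open>f\<close> over the unobserved coordinates does as well.\<close>

lemma cond_next_bounds:
  fixes I :: "nat \<Rightarrow> real set"
  assumes int1: "integrable M (X 1)" and f: "cond_exp_version M X f"
    and C: "C \<in> sets (\<Pi>\<^sub>M i\<in>UNIV. borel)" "measure (distr M (\<Pi>\<^sub>M i\<in>UNIV. borel) (past X)) C = 1"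
    and I: "\<And>i. I i \<in> sets borel"
    and bd: "\<And>y. y \<in> C \<Longrightarrow> (\<And>i. i < m \<Longrightarrow> y i \<in> I i) \<Longrightarrow> a \<le> f y \<and> f y \<le> b"
  shows "AE \<omega> in M. m \<le> k \<longrightarrow> (\<forall>i<m. past_of (seen k \<omega>) i \<in> I i) \<longrightarrow>
    a \<le> cond_next k \<omega> \<and> cond_next k \<omega> \<le> b"
proof -
  have [measurable]: "f \<in> borel_measurable (\<Pi>\<^sub>M i\<in>UNIV. borel)"
    using f by (simp add: cond_exp_version_def)
  define S where "S = {\<omega> \<in> space M. (\<exists>n\<ge>m. Z k \<omega> = enat n) \<and> (\<forall>i<m. seen k \<omega> (- int i) \<in> I i)}"
  have "AE \<omega> in M. \<omega> \<in> S \<longrightarrow> a \<le> real_cond_exp M (F k) (\<lambda>\<omega>. seen k \<omega> 1) \<omega> \<and>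
      real_cond_exp M (F k) (\<lambda>\<omega>. seen k \<omega> 1) \<omega> \<le> b"
  proof (rule cond_exp_bounds_on[OF subalgebra_F])
    show "integrable M (\<lambda>\<omega>. seen k \<omega> 1)"
      using integrable_seen[of "\<lambda>x. x 1" k] int1 by simp
    show "integrable M (\<lambda>\<omega>. f (past_of (seen k \<omega>)))"
      using integrable_seen[of "\<lambda>x. f (past_of x)" k] integrable_version[OF int1 f] by simp
    show "(\<integral>\<omega>\<in>A. seen k \<omega> 1 \<partial>M) = (\<integral>\<omega>\<in>A. f (past_of (seen k \<omega>)) \<partial>M)" if "A \<in> sets (F k)" for A
      by (rule next_value_integral_stopped[OF int1 f that])
    show "S \<in> sets (F k)" unfolding S_def by (rule cylinder_in_F[OF I])
    show "AE \<omega> in M. \<omega> \<in> S \<longrightarrow> a \<le> f (past_of (seen k \<omega>)) \<and> f (past_of (seen k \<omega>)) \<le> b"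
      using AE_past_in_support[OF C, of k]
    proof eventually_elim
      case (elim \<omega>)
      then show ?case using bd[of "past_of (seen k \<omega>)"] by (auto simp: S_def past_of_def)
    qed
  qed
  with AE_zeta_finite AE_space show ?thesis
  proof eventually_elim
    case (elim \<omega>)
    show ?case
    proof (intro impI)
      assume "m \<le> k" and *: "\<forall>i<m. past_of (seen k \<omega>) i \<in> I i"
      obtain n where n: "Z k \<omega> = enat n" using elim(1) by auto
      then have "m \<le> n" using zeta_ge[OF n] \<open>m \<le> k\<close> by simp
      then have "\<omega> \<in> S" using n * elim(2) by (auto simp: S_def past_of_def)
      then show "a \<le> cond_next k \<omega> \<and> cond_next k \<omega> \<le> b" using elim(3) by (simp add: cond_next_def)
    qed
  qed
qed

text \<open>The exceptional null set may not depend on the random limit \<open>c\<close> of the pasts. Therefore the bounds on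
  the conditional expectations are first made simultaneous for the countably many cylinders
  with rational centres and rational bounds, and a suitable one is chosen at each path.\<close>

lemma AE_cond_next_converges:
  assumes fine: "\<And>x. (\<lambda>k. ediam (cell (P k) x)) \<longlonglongrightarrow> 0"
    and l_lim: "filterlim l at_top sequentially"
    and int1: "integrable M (X 1)" and cont: "cond_exp_as_continuous M X"
  shows "AE \<omega> in M. convergent (\<lambda>k. cond_next k \<omega>)"
proof -
  obtain f C where f: "cond_exp_version M X f"
    and C: "C \<in> sets (\<Pi>\<^sub>M i\<in>UNIV. borel)" "measure (distr M (\<Pi>\<^sub>M i\<in>UNIV. borel) (past X)) C = 1"
    and cf: "continuous_map (subtopology (Metric_space.mtopology UNIV past_dist) C) euclideanreal f"
    using cont unfolding cond_exp_as_continuous_def by blast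
  define I :: "rat list \<Rightarrow> nat \<Rightarrow> nat \<Rightarrow> real set" where "I qs p i = ball (of_rat (qs ! i)) (1 / Suc p)" for qs p i
  \<comment> \<open>The sequence \<open>qs\<close> lists the centres of the sides, of length \<open>2 / Suc p\<close>, of a cube in
    the first \<open>length qs\<close> coordinates.\<close>
  define good :: "rat list \<Rightarrow> nat \<Rightarrow> rat \<Rightarrow> rat \<Rightarrow> bool" where
    "good qs p a b \<longleftrightarrow> (\<forall>y\<in>C. (\<forall>i<length qs. y i \<in> I qs p i) \<longrightarrow> of_rat a \<le> f y \<and> f y \<le> of_rat b)" for qs p a b
  have "AE \<omega> in M. good qs p a b \<longrightarrow> (length qs \<le> k \<longrightarrow> (\<forall>i<length qs. past_of (seen k \<omega>) i \<in> I qs p i) \<longrightarrow>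
      of_rat a \<le> cond_next k \<omega> \<and> cond_next k \<omega> \<le> of_rat b)" for qs p a b k
  proof (cases "good qs p a b")
    case True
    have "AE \<omega> in M. length qs \<le> k \<longrightarrow> (\<forall>i<length qs. past_of (seen k \<omega>) i \<in> I qs p i) \<longrightarrow>
        of_rat a \<le> cond_next k \<omega> \<and> cond_next k \<omega> \<le> of_rat b"
    proof (rule cond_next_bounds[OF int1 f C])
      show "I qs p i \<in> sets borel" for i by (simp add: I_def)
    qed (use True in \<open>auto simp: good_def\<close>)
    then show ?thesis by (auto elim!: eventually_mono)
  qed simp
  then have "AE \<omega> in M. \<forall>qs p a b k. good qs p a b \<longrightarrow> (length qs \<le> k \<longrightarrow>
      (\<forall>i<length qs. past_of (seen k \<omega>) i \<in> I qs p i) \<longrightarrow>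
      of_rat a \<le> cond_next k \<omega> \<and> cond_next k \<omega> \<le> of_rat b)"
    by (simp only: AE_all_countable) blast
  with AE_past_converges_in_support[OF fine l_lim C] show ?thesis
  proof eventually_elim
    case (elim \<omega>)
    obtain c where "c \<in> C" and c: "\<And>i. (\<lambda>k. past_of (seen k \<omega>) i) \<longlonglongrightarrow> c i"
      using elim(1) by blast
    have "(\<lambda>k. cond_next k \<omega>) \<longlonglongrightarrow> f c"
    proof (rule LIMSEQ_I)
      fix e :: real assume "0 < e"
      then have "0 < e / 4" by simp
      from continuous_on_past_finite_coordinates[OF cf \<open>c \<in> C\<close> this]
      obtain m \<delta> where "0 < \<delta>"
        and near: "\<And>y. y \<in> C \<Longrightarrow> \<forall>i<m. \<bar>c i - y i\<bar> < \<delta> \<Longrightarrow> \<bar>f y - f c\<bar> < e / 4"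
        by blast
      \<comment> \<open>The cube below contains the first coordinates of \<open>c\<close>, so all its points are within
        \<open>2 / Suc p\<close> of them.\<close>
      obtain p where p: "1 / Suc p < \<delta> / 2" using nat_approx_posE[of "\<delta> / 2"] \<open>0 < \<delta>\<close> by auto
      have "\<exists>q. \<bar>c i - of_rat q\<bar> < 1 / Suc p" for i
      proof -
        obtain q where "c i - 1 / Suc p < of_rat q" "of_rat q < c i + 1 / Suc p"
          using of_rat_dense[of "c i - 1 / Suc p" "c i + 1 / Suc p"] by auto
        then show ?thesis by (intro exI[of _ q]) linarith
      qed
      then obtain q where q: "\<And>i. \<bar>c i - of_rat (q i)\<bar> < 1 / Suc p" by metis
      define qs where "qs = map q [0..<m]"
      have I_iff: "y \<in> I qs p i \<longleftrightarrow> \<bar>of_rat (q i) - y\<bar> < 1 / Suc p" if "i < m" for i y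
        using that by (simp add: I_def qs_def dist_real_def)
      \<comment> \<open>The gap between \<open>e / 4\<close> and \<open>e / 2\<close> leaves room for rational bounds.\<close>
      obtain a where a: "f c - e / 2 < of_rat a" "of_rat a < f c - e / 4"
        using of_rat_dense[of "f c - e / 2" "f c - e / 4"] \<open>0 < e\<close> by auto
      obtain b where b: "f c + e / 4 < of_rat b" "of_rat b < f c + e / 2"
        using of_rat_dense[of "f c + e / 4" "f c + e / 2"] \<open>0 < e\<close> by auto
      have "good qs p a b"
        unfolding good_def
      proof (intro ballI impI)
        fix y assume "y \<in> C" and y: "\<forall>i<length qs. y i \<in> I qs p i"
        have "\<bar>c i - y i\<bar> < \<delta>" if "i < m" for i
        proof -
          have "y i \<in> I qs p i" using y that by (simp add: qs_def)
          then have "\<bar>of_rat (q i) - y i\<bar> < 1 / Suc p" using I_iff[OF that] by simp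
          then show ?thesis using q[of i] p by linarith
        qed
        from near[OF \<open>y \<in> C\<close>] this have "\<bar>f y - f c\<bar> < e / 4" by blast
        then show "of_rat a \<le> f y \<and> f y \<le> of_rat b" using a b by linarith
      qed
      have "\<forall>\<^sub>F k in sequentially. past_of (seen k \<omega>) i \<in> I qs p i" if "i < m" for i
        by (rule topological_tendstoD[OF c])
          (use q[of i] that in \<open>auto simp: I_def qs_def dist_real_def abs_minus_commute\<close>)
      then have "\<forall>\<^sub>F k in sequentially. \<forall>i\<in>{..<m}. past_of (seen k \<omega>) i \<in> I qs p i"
        by (intro eventually_ball_finite) auto
      then obtain N where N: "\<And>k i. N \<le> k \<Longrightarrow> i < m \<Longrightarrow> past_of (seen k \<omega>) i \<in> I qs p i"
        unfolding eventually_sequentially by auto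
      have "norm (cond_next k \<omega> - f c) < e" if "max N m \<le> k" for k
      proof -
        have "of_rat a \<le> cond_next k \<omega> \<and> cond_next k \<omega> \<le> of_rat b"
          using elim(2) \<open>good qs p a b\<close> N[of k] that by (simp add: qs_def)
        then show ?thesis using a b \<open>0 < e\<close> by (simp add: abs_less_iff)
      qed
      then show "\<exists>no. \<forall>n\<ge>no. norm (cond_next n \<omega> - f c) < e" by blast
    qed
    then show ?case by (rule convergentI)
  qed
qed

lemma AE_innovations_average:
  assumes sq: "integrable M (\<lambda>\<omega>. (X 0 \<omega>)\<^sup>2)"
  shows "AE \<omega> in M. (\<lambda>n. (\<Sum>j<n. seen j \<omega> 1 - cond_next j \<omega>) / real n) \<longlonglongrightarrow> 0"
  unfolding cond_next_def
proof (rule martingale_difference_strong_law[where G = F])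
  show "(\<lambda>\<omega>. seen j \<omega> 1) \<in> borel_measurable (F k)" if "j < k" for j k
    by (rule measurable_next_obs_F[OF that])
  have "integrable M (\<lambda>\<omega>. (X 1 \<omega>)\<^sup>2)"
    using integrable_shift[of "\<lambda>x. (x 0)\<^sup>2" 1] sq by (simp add: time_shift_def)
  then show "integrable M (\<lambda>\<omega>. (seen k \<omega> 1)\<^sup>2)" for k
    using integrable_seen[of "\<lambda>x. (x 1)\<^sup>2" k] by simp
  show "(\<integral>\<omega>. (seen k \<omega> 1)\<^sup>2 \<partial>M) \<le> (\<integral>\<omega>. (X 1 \<omega>)\<^sup>2 \<partial>M)" for k
    using integral_seen[of "\<lambda>x. (x 1)\<^sup>2" k] by simp
qed (use subalgebra_F sets_F_mono in auto)

end

section \<open>Consistency of the estimator\<close>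

theorem theorem1:
  fixes M :: "'a measure"
    and X :: "int \<Rightarrow> 'a \<Rightarrow> real"
    and P :: "nat \<Rightarrow> real set set"
    and l :: "nat \<Rightarrow> nat"
  assumes "prob_space M"
    and "\<And>n. X n \<in> borel_measurable M"
    and "stationary M X"
    and "integrable M (\<lambda>\<omega>. \<bar>X 0 \<omega>\<bar>\<^sup>2)"
    and "nested_interval_partitions P"
    and "\<And>x. (\<lambda>k. ediam (cell (P k) x)) \<longlonglongrightarrow> 0"
    and "mono_on {1..} l"
    and "\<And>k. 1 \<le> k \<Longrightarrow> 1 \<le> l k \<and> l k \<le> k"
    and "filterlim l at_top sequentially"
    and "cond_exp_as_continuous M X"
  shows "AE \<omega> in M.
    (\<lambda>k. \<bar>estimator P l (\<lambda>n. X n \<omega>) k -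
          real_cond_exp M (stopped_sigma M X (\<lambda>\<omega>'. zeta P l (\<lambda>n. X n \<omega>') k))
            (\<lambda>\<omega>'. next_obs P l (\<lambda>n. X n \<omega>') k) \<omega>\<bar>) \<longlonglongrightarrow> 0"
proof -
  interpret prob_space M by fact
  interpret quantized_recurrence M X P l
    by unfold_locales (use assms in auto)
  have sq: "integrable M (\<lambda>\<omega>. (X 0 \<omega>)\<^sup>2)" using assms(4) by simp
  have "integrable M (X 0)" using integrable_mult_of_squares[of "X 0" M "\<lambda>_. 1"] sq by simp
  then have int1: "integrable M (X 1)"
    using integrable_shift[of "\<lambda>x. x 0" 1] by (simp add: time_shift_def)
  have "AE \<omega> in M. (\<lambda>k. \<bar>estimator P l (\<lambda>n. X n \<omega>) k - cond_next k \<omega>\<bar>) \<longlonglongrightarrow> 0"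
    using AE_cond_next_converges[OF assms(6,9) int1 assms(10)] AE_innovations_average[OF sq]
  proof eventually_elim
    case (elim \<omega>)
    then obtain L where L: "(\<lambda>k. cond_next k \<omega>) \<longlonglongrightarrow> L" unfolding convergent_def by blast
    have "estimator P l (\<lambda>n. X n \<omega>) k =
        (\<Sum>j<k. seen j \<omega> 1 - cond_next j \<omega>) / real k + (\<Sum>j<k. cond_next j \<omega>) / real k" for k
      unfolding estimator_def next_obs_eq by (simp add: sum_subtractf diff_divide_distrib)
    then have "(\<lambda>k. \<bar>estimator P l (\<lambda>n. X n \<omega>) k - cond_next k \<omega>\<bar>) \<longlonglongrightarrow> \<bar>0 + L - L\<bar>"
      using elim(2) L tendsto_cesaro[OF L] by (simp only:) (intro tendsto_intros)
    then show ?case by simp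
  qed
  then show ?thesis unfolding cond_next_def next_obs_eq .
qed

end
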